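(* Consider the two-class contextual stochastic block model defined in the context and focus on target nodes $i$ with $$K=|\mathcal N(i)|>1.$$ Under the global Gaussian noise $$h_i=y_i\mu+\sigma\varepsilon_i,\qquad \varepsilon_i\sim\mathcal N(0,I_d),\qquad \sigma>0,$$ with the weighted $\ell_1$ attention logit $$e_{ij}=-\sum_{\ell=1}^d w_\ell\,|h_{i\ell}-h_{j\ell}|,\qquad w_\ell>0,$$ let the fixed-temperature baseline correspond to the choice $T=1$, and let the mechanism with learnable temperature choose $T>0$. Then $$\sup_{T>0}\mathrm{SNR}(T)\ \ge\ \mathrm{SNR}(1).$$ Moreover, as $\sigma\to\infty$, the attention logits become asymptotically uninformative about neighbor labels. In this high-noise limit, choosing a temperature $T$ sufficiently large relative to the logit scale reduces attention-concentration variance while preserving the leading signal, and yields $$\mathrm{SNR}(T)>\mathrm{SNR}(1).$$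
   Context: **Graph model (two-class contextual stochastic block model).** $G=(V,E)$ is a random graph in which each node $i\in V$ has a label $y_i\in\{-1,+1\}$ with $\mathbb P(y_i=+1)=\mathbb P(y_i=-1)=\tfrac12$. Edges are generated according to $\mathbb P((i,j)\in E\mid y_i=y_j)=a/n$ and $\mathbb P((i,j)\in E\mid y_i\ne y_j)=b/n$, with $a>b>0$ (here $n$ is the number of nodes). For a target node $i$, $\mathcal N(i)$ is its aggregation set (its neighbors, without the self-loop) and $K:=|\mathcal N(i)|$. Conditioned on $y_i$, the label of a random node $j\in\mathcal N(i)$ satisfies $\mathbb E[y_j\mid y_i,\ j\in\mathcal N(i)]=m\,y_i$ with $m:=\frac{a-b}{a+b}>0$. **Features.** $\mu\in\mathbb R^d$ is the class signal vector. The noiseless feature of node $i$ is $y_i\mu$. Under global Gaussian noise all coordinates are perturbed by isotropic, label-independent Gaussian noise of level $\sigma$, as displayed in the claim; $h_{i\ell}$ is the $\ell$-th coordinate of $h_i$. **Attention.** For a temperature $T>0$, the attention coefficients are $$\alpha_{ij}^{(T)}=\frac{\exp(e_{ij}/T)}{\sum_{r\in\mathcal N(i)}\exp(e_{ir}/T)},\qquad j\in\mathcal N(i).$$ **Node-level metric.** $R_i^{(T)}:=\sum_{j\in\mathcal N(i)}\alpha_{ij}^{(T)}y_j$ is the attention-weighted neighbor-label score, and $$\mathrm{SNR}(T):=\frac{\mathbb E[R_i^{(T)}\mid y_i=+1]-\mathbb E[R_i^{(T)}\mid y_i=-1]}{\sqrt{\mathrm{Var}(R_i^{(T)}\mid y_i=+1)+\mathrm{Var}(R_i^{(T)}\mid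 y_i=-1)}}$$ is the node-level signal-to-noise ratio. The "signal" is its numerator; "attention-concentration variance" refers to the part of the variance of $R_i^{(T)}$ caused by the attention coefficients being concentrated on few neighbors. *)

theory Defs
  imports "HOL-Probability.Probability"
begin

text \<open>
  Nodes are \<open>{..<n}\<close>. The graph part of an outcome consists of the labels and the set of edges,
  an edge being a two-element set of nodes. Labels outside \<open>{..<n}\<close> are \<open>0\<close> and never used.
\<close>

definition csbm_graph :: "nat \<Rightarrow> real \<Rightarrow> real \<Rightarrow> ((nat \<Rightarrow> real) \<times> nat set set) pmf" where
  "csbm_graph n a b =
     bind_pmf (Pi_pmf {..<n} 0 (\<lambda>_. pmf_of_set {-1, 1})) (\<lambda>y.
     bind_pmf (Pi_pmf {e. e \<subseteq> {..<n} \<and> card e = 2} False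
                 (\<lambda>e. bernoulli_pmf (if card (y ` e) = 1 then a / real n else b / real n))) (\<lambda>X.
     return_pmf (y, {e. X e})))"

definition std_gaussian :: "(real^'d) measure" where
  "std_gaussian = density lborel (\<lambda>x. ennreal (\<Prod>l\<in>UNIV. std_normal_density (x $ l)))"

type_synonym 'd outcome = "((nat \<Rightarrow> real) \<times> nat set set) \<times> (nat \<Rightarrow> real^'d)"

text \<open>
  The noise vectors are i.i.d. standard Gaussian and independent of labels and edges; the noise
  level \<open>\<sigma>\<close> enters only through the features, so all noise levels live on the same space.
\<close>

definition csbm :: "nat \<Rightarrow> real \<Rightarrow> real \<Rightarrow> ('d::finite) outcome measure" where
  "csbm n a b = measure_pmf (csbm_graph n a b) \<Otimes>\<^sub>M (\<Pi>\<^sub>M j\<in>{..<n}. std_gaussian)"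

definition label :: "('d::finite) outcome \<Rightarrow> nat \<Rightarrow> real" where
  "label \<omega> = fst (fst \<omega>)"

definition noise :: "('d::finite) outcome \<Rightarrow> nat \<Rightarrow> real^'d" where
  "noise \<omega> = snd \<omega>"

definition nbhd :: "nat \<Rightarrow> nat \<Rightarrow> ('d::finite) outcome \<Rightarrow> nat set" where
  "nbhd n i \<omega> = {j \<in> {..<n} - {i}. {i, j} \<in> snd (fst \<omega>)}"

definition homophily :: "real \<Rightarrow> real \<Rightarrow> real" where
  "homophily a b = (a - b) / (a + b)"

definition feature :: "real^'d \<Rightarrow> real \<Rightarrow> ('d::finite) outcome \<Rightarrow> nat \<Rightarrow> real^'d" where
  "feature \<mu> \<sigma> \<omega> j = label \<omega> j *\<^sub>R \<mu> + \<sigma> *\<^sub>R noise \<omega> j"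

definition logit :: "real^'d \<Rightarrow> real^'d \<Rightarrow> real \<Rightarrow> nat \<Rightarrow> ('d::finite) outcome \<Rightarrow> nat \<Rightarrow> real" where
  "logit \<mu> w \<sigma> i \<omega> j =
     - (\<Sum>l\<in>UNIV. w $ l * \<bar>feature \<mu> \<sigma> \<omega> i $ l - feature \<mu> \<sigma> \<omega> j $ l\<bar>)"

definition attention ::
  "nat \<Rightarrow> nat \<Rightarrow> real^'d \<Rightarrow> real^'d \<Rightarrow> real \<Rightarrow> real \<Rightarrow> ('d::finite) outcome \<Rightarrow> nat \<Rightarrow> real" where
  "attention n i \<mu> w \<sigma> T \<omega> j =
     exp (logit \<mu> w \<sigma> i \<omega> j / T) / (\<Sum>r\<in>nbhd n i \<omega>. exp (logit \<mu> w \<sigma> i \<omega> r / T))"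

definition score ::
  "nat \<Rightarrow> nat \<Rightarrow> real^'d \<Rightarrow> real^'d \<Rightarrow> real \<Rightarrow> real \<Rightarrow> ('d::finite) outcome \<Rightarrow> real" where
  "score n i \<mu> w \<sigma> T \<omega> = (\<Sum>j\<in>nbhd n i \<omega>. attention n i \<mu> w \<sigma> T \<omega> j * label \<omega> j)"

text \<open>
  The model conditioned on the target node \<open>i\<close> having label \<open>c\<close> and a number of neighbours in \<open>Ks\<close>.
  A fixed number of neighbours \<open>k\<close> is \<open>Ks = {k}\<close>; merely requiring more than one neighbour
  is \<open>Ks = {1<..<n}\<close>.
\<close>

definition target_model ::
  "nat \<Rightarrow> real \<Rightarrow> real \<Rightarrow> nat \<Rightarrow> nat set \<Rightarrow> real \<Rightarrow> ('d::finite) outcome measure" where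
  "target_model n a b i Ks c =
     uniform_measure (csbm n a b)
       {\<omega> \<in> space (csbm n a b). label \<omega> i = c \<and> card (nbhd n i \<omega>) \<in> Ks}"

definition score_mean ::
  "nat \<Rightarrow> real \<Rightarrow> real \<Rightarrow> nat \<Rightarrow> nat set \<Rightarrow> real^('d::finite) \<Rightarrow> real^'d \<Rightarrow> real \<Rightarrow> real \<Rightarrow> real \<Rightarrow> real" where
  "score_mean n a b i Ks \<mu> w \<sigma> T c =
     prob_space.expectation (target_model n a b i Ks c) (score n i \<mu> w \<sigma> T)"

definition score_var ::
  "nat \<Rightarrow> real \<Rightarrow> real \<Rightarrow> nat \<Rightarrow> nat set \<Rightarrow> real^('d::finite) \<Rightarrow> real^'d \<Rightarrow> real \<Rightarrow> real \<Rightarrow> real \<Rightarrow> real" where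
  "score_var n a b i Ks \<mu> w \<sigma> T c =
     prob_space.variance (target_model n a b i Ks c) (score n i \<mu> w \<sigma> T)"

definition signal ::
  "nat \<Rightarrow> real \<Rightarrow> real \<Rightarrow> nat \<Rightarrow> nat set \<Rightarrow> real^('d::finite) \<Rightarrow> real^'d \<Rightarrow> real \<Rightarrow> real \<Rightarrow> real" where
  "signal n a b i Ks \<mu> w \<sigma> T =
     score_mean n a b i Ks \<mu> w \<sigma> T 1 - score_mean n a b i Ks \<mu> w \<sigma> T (-1)"

definition SNR ::
  "nat \<Rightarrow> real \<Rightarrow> real \<Rightarrow> nat \<Rightarrow> nat set \<Rightarrow> real^('d::finite) \<Rightarrow> real^'d \<Rightarrow> real \<Rightarrow> real \<Rightarrow> real" where
  "SNR n a b i Ks \<mu> w \<sigma> T =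
     signal n a b i Ks \<mu> w \<sigma> T /
     sqrt (score_var n a b i Ks \<mu> w \<sigma> T 1 + score_var n a b i Ks \<mu> w \<sigma> T (-1))"

text \<open>
  Given the neighbourhood and \<open>y\<^sub>i\<close>, neighbour labels are independent with variance \<open>1 - m\<^sup>2\<close>, so
  weights \<open>\<alpha>\<^sub>j\<close> that are independent of these labels give the score the variance
  \<open>(1 - m\<^sup>2) E(\<Sum>\<^sub>j \<alpha>\<^sub>j\<^sup>2) = (1 - m\<^sup>2) E(1/K) + (1 - m\<^sup>2) E(\<Sum>\<^sub>j (\<alpha>\<^sub>j - 1/K)\<^sup>2)\<close>.
  The first summand is the variance under uniform weights; the second is what concentration of the
  weights on few neighbours adds.
\<close>

definition concentration_var ::
  "nat \<Rightarrow> real \<Rightarrow> real \<Rightarrow> nat \<Rightarrow> nat set \<Rightarrow> real^('d::finite) \<Rightarrow> real^'d \<Rightarrow> real \<Rightarrow> real \<Rightarrow> real \<Rightarrow> real" where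
  "concentration_var n a b i Ks \<mu> w \<sigma> T c =
     (1 - (homophily a b)\<^sup>2) *
     prob_space.expectation (target_model n a b i Ks c)
       (\<lambda>\<omega>. \<Sum>j\<in>nbhd n i \<omega>. (attention n i \<mu> w \<sigma> T \<omega> j - 1 / real (card (nbhd n i \<omega>)))\<^sup>2)"

definition tv_dist :: "'a measure \<Rightarrow> 'a measure \<Rightarrow> real" where
  "tv_dist P Q = (SUP B\<in>sets P. \<bar>measure P B - measure Q B\<bar>)"

definition logit_law ::
  "nat \<Rightarrow> real \<Rightarrow> real \<Rightarrow> nat \<Rightarrow> real^('d::finite) \<Rightarrow> real^'d \<Rightarrow> real \<Rightarrow> nat set \<Rightarrow>
   ('d outcome \<Rightarrow> bool) \<Rightarrow> (nat \<Rightarrow> real) measure" where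
  "logit_law n a b i \<mu> w \<sigma> S A =
     distr (uniform_measure (csbm n a b) {\<omega> \<in> space (csbm n a b). A \<omega>})
       (\<Pi>\<^sub>M j\<in>S. borel) (\<lambda>\<omega>. \<lambda>j\<in>S. logit \<mu> w \<sigma> i \<omega> j)"

text \<open>
  Asymptotically, the joint law of all logits of the target node does not change when it is
  further conditioned on the labels of the neighbours.
\<close>

definition logits_asymp_uninformative ::
  "nat \<Rightarrow> real \<Rightarrow> real \<Rightarrow> nat \<Rightarrow> nat set \<Rightarrow> real^('d::finite) \<Rightarrow> real^'d \<Rightarrow> bool" where
  "logits_asymp_uninformative n a b i Ks \<mu> w \<longleftrightarrow>
     (\<forall>c\<in>{-1, 1}. \<forall>S. S \<subseteq> {..<n} - {i} \<longrightarrow> card S \<in> Ks \<longrightarrow> (\<forall>s. (\<forall>j\<in>S. s j \<in> {-1, 1}) \<longrightarrow>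
       ((\<lambda>\<sigma>. tv_dist
           (logit_law n a b i \<mu> w \<sigma> S
              (\<lambda>\<omega>. label \<omega> i = c \<and> nbhd n i \<omega> = S \<and> (\<forall>j\<in>S. label \<omega> j = s j)))
           (logit_law n a b i \<mu> w \<sigma> S
              (\<lambda>\<omega>. label \<omega> i = c \<and> nbhd n i \<omega> = S)))
         \<longlongrightarrow> 0) at_top))"

end

theory Submission
  imports Defs
begin

text \<open>
  The labels move every logit by at most a constant that does not depend on the noise level, so at
  temperature \<open>T\<close> the attention weights differ from weights \<open>\<alpha>\<^sup>0\<close> computed from the noise alone by an
  amount that vanishes as \<open>T \<rightarrow> \<infinity>\<close>. Given the neighbourhood, \<open>\<alpha>\<^sup>0\<close> is independent of the labels, hence
  the score it defines has mean \<open>m c\<close> and variance \<open>(1 - m\<^sup>2) E(\<Sum>\<^sub>j (\<alpha>\<^sup>0\<^sub>j)\<^sup>2)\<close>. For \<open>T \<ge> \<sigma>\<close> the noise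
  logits divided by \<open>T\<close> stay bounded and \<open>E(\<Sum>\<^sub>j (\<alpha>\<^sup>0\<^sub>j)\<^sup>2)\<close> stays away from \<open>1\<close>. At \<open>T = 1\<close> the weights
  concentrate, as \<open>\<sigma> \<rightarrow> \<infinity>\<close>, on the neighbour whose noise is nearest, which is almost surely unique;
  there \<open>\<Sum>\<^sub>j \<alpha>\<^sub>j\<^sup>2 \<rightarrow> 1\<close>. The means agree in the limit, so the comparison of the signal-to-noise
  ratios is decided by the variances. Uninformativeness of the logits is the continuity of
  translations in \<open>L\<^sup>1\<close> for the Gaussian density, because the labels shift the noise by \<open>O(1/\<sigma>)\<close>.
\<close>

section \<open>Softmax weights\<close>

text \<open>The bound on the effect of the labels is a reverse triangle inequality for the weighted
  l1 distance. It helps only when T is large: \<open>perturbation 1\<close> is a fixed number that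
  no \<sigma> makes small. Hence the two temperatures need different arguments. For T \<ge> \<sigma>
  every error is explicit and decreasing in T, so that one threshold for \<sigma> serves an
  unbounded range of T. At T = 1 the true score and the noise score are compared outcome by outcome:
  the gap between the nearest neighbour and the others is multiplied by \<sigma> while the labels
  contribute a constant, so both scores converge to the label of the same neighbour. The gap is
  random, so this gives limits by dominated convergence and no rate. The mean of that label is never
  computed directly, because the noise score has mean exactly \<open>m * c\<close> for every
  \<sigma>.\<close>

definition softmax :: "'a set \<Rightarrow> ('a \<Rightarrow> real) \<Rightarrow> 'a \<Rightarrow> real" where
  "softmax U e j = exp (e j) / (\<Sum>r\<in>U. exp (e r))"

lemma softmax_nonneg: "0 \<le> softmax U e j"
  unfolding softmax_def by (simp add: sum_nonneg)

lemma sum_softmax: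
  assumes "finite U" "U \<noteq> {}"
  shows "(\<Sum>j\<in>U. softmax U e j) = 1"
proof -
  have "(\<Sum>r\<in>U. exp (e r)) > 0"
    using assms by (intro sum_pos) auto
  then show ?thesis
    unfolding softmax_def by (simp flip: sum_divide_distrib)
qed

lemma softmax_le_1:
  assumes "finite U" "j \<in> U"
  shows "softmax U e j \<le> 1"
proof -
  have "softmax U e j \<le> (\<Sum>r\<in>U. softmax U e r)"
    using assms by (intro member_le_sum) (auto simp: softmax_nonneg)
  then show ?thesis
    using assms by (subst (asm) sum_softmax) auto
qed

text \<open>Numerator and normalizing sum each change by a factor of at most \<open>exp D\<close>,
  which gives the exponent \<open>2 * D\<close>.\<close>

lemma softmax_le_exp_mult:
  assumes U: "finite U" "j \<in> U" and D: "\<And>r. r \<in> U \<Longrightarrow> \<bar>e r - e' r\<bar> \<le> D"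
  shows "softmax U e j \<le> exp (2 * D) * softmax U e' j"
proof -
  have pos: "(\<Sum>r\<in>U. exp (e r)) > 0" "(\<Sum>r\<in>U. exp (e' r)) > 0"
    using U by (auto intro!: sum_pos)
  have "(\<Sum>r\<in>U. exp (e' r)) \<le> (\<Sum>r\<in>U. exp D * exp (e r))"
  proof (rule sum_mono)
    fix r assume "r \<in> U"
    then show "exp (e' r) \<le> exp D * exp (e r)"
      using D[of r] by (simp flip: exp_add)
  qed
  then have *: "(\<Sum>r\<in>U. exp (e' r)) \<le> exp D * (\<Sum>r\<in>U. exp (e r))"
    by (simp add: sum_distrib_left)
  have "exp (e j) \<le> exp D * exp (e' j)"
    using D[OF U(2)] by (simp flip: exp_add)
  then have "exp (e j) * (\<Sum>r\<in>U. exp (e' r))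
      \<le> (exp D * exp (e' j)) * (exp D * (\<Sum>r\<in>U. exp (e r)))"
    using * pos by (intro mult_mono) auto
  also have "\<dots> = exp (2 * D) * exp (e' j) * (\<Sum>r\<in>U. exp (e r))"
    by (simp add: exp_double power2_eq_square)
  finally have "exp (e j) / (\<Sum>r\<in>U. exp (e r))
      \<le> exp (2 * D) * exp (e' j) / (\<Sum>r\<in>U. exp (e' r))"
    using pos by (simp only: pos_divide_le_eq pos_le_divide_eq times_divide_eq_left)
  then show ?thesis
    unfolding softmax_def by simp
qed

text \<open>The multiplicative comparison, used in both directions, becomes additive because weights
  are at most 1.\<close>

lemma softmax_perturb:
  assumes U: "finite U" "j \<in> U" and D: "\<And>r. r \<in> U \<Longrightarrow> \<bar>e r - e' r\<bar> \<le> D"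
  shows "\<bar>softmax U e j - softmax U e' j\<bar> \<le> exp (2 * D) - 1"
proof -
  have "0 \<le> D" using D[OF U(2)] by linarith
  then have E: "0 \<le> exp (2 * D) - 1" by simp
  have "softmax U e j \<le> exp (2 * D) * softmax U e' j"
    using D by (intro softmax_le_exp_mult U)
  then have "softmax U e j - softmax U e' j \<le> (exp (2 * D) - 1) * softmax U e' j"
    by (simp add: left_diff_distrib)
  also have "\<dots> \<le> exp (2 * D) - 1"
    using E softmax_le_1[OF U] by (simp add: mult_left_le)
  finally have 1: "softmax U e j - softmax U e' j \<le> exp (2 * D) - 1" .
  have "softmax U e' j \<le> exp (2 * D) * softmax U e j"
    using D by (intro softmax_le_exp_mult U) (simp add: abs_minus_commute)
  then have "softmax U e' j - softmax U e j \<le> (exp (2 * D) - 1) * softmax U e j"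
    by (simp add: left_diff_distrib)
  also have "\<dots> \<le> exp (2 * D) - 1"
    using E softmax_le_1[OF U] by (simp add: mult_left_le)
  finally show ?thesis using 1 by linarith
qed

text \<open>Keeping only the term of \<open>k\<close> in the normalizing sum bounds each other
  weight by \<open>exp (- \<gamma>)\<close>; what they do not take is left to
  \<open>k\<close>.\<close>

lemma softmax_concentrates:
  assumes U: "finite U" "k \<in> U" and gap: "\<And>r. r \<in> U \<Longrightarrow> r \<noteq> k \<Longrightarrow> e r + \<gamma> \<le> e k"
  shows "1 - softmax U e k \<le> card U * exp (- \<gamma>)"
proof -
  have ge: "exp (e k) \<le> (\<Sum>r\<in>U. exp (e r))"
    using U by (intro member_le_sum) auto
  have "softmax U e r \<le> exp (- \<gamma>)" if "r \<in> U - {k}" for r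
  proof -
    have "softmax U e r \<le> exp (e r) / exp (e k)"
      unfolding softmax_def using ge by (intro divide_left_mono) (auto intro!: mult_pos_pos less_le_trans[OF _ ge])
    also have "\<dots> = exp (e r - e k)" by (simp add: exp_diff)
    also have "\<dots> \<le> exp (- \<gamma>)" using gap[of r] that by simp
    finally show ?thesis .
  qed
  then have "(\<Sum>r\<in>U - {k}. softmax U e r) \<le> (\<Sum>r\<in>U - {k}. exp (- \<gamma>))"
    by (rule sum_mono)
  also have "\<dots> \<le> card U * exp (- \<gamma>)"
    using U by (simp add: card_Diff_singleton)
  finally show ?thesis
    using sum_softmax[of U e] sum.remove[OF U, of "softmax U e"] U
    by (cases "U = {}") auto
qed

lemma softmax_ge:
  assumes U: "finite U" "j \<in> U" and e: "\<And>r. r \<in> U \<Longrightarrow> e r \<le> 0" and L: "L \<le> e j"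
  shows "exp L / card U \<le> softmax U e j"
proof -
  have "(\<Sum>r\<in>U. exp (e r)) \<le> (\<Sum>r\<in>U. 1)"
    by (intro sum_mono) (use e in auto)
  then show ?thesis
    unfolding softmax_def using U L
    by (intro frac_le) (auto intro!: sum_pos)
qed

text \<open>The sum of squares is the average of the weights with respect to themselves, hence lies
  between their extremes. No weight exceeds \<open>1 - q\<close>, since a second element retains at
  least \<open>q\<close>.\<close>

lemma sum_softmax_squares_bounds:
  assumes U: "finite U" "2 \<le> card U" and q: "\<And>j. j \<in> U \<Longrightarrow> q \<le> softmax U e j"
  shows "q \<le> (\<Sum>j\<in>U. (softmax U e j)\<^sup>2)" "(\<Sum>j\<in>U. (softmax U e j)\<^sup>2) \<le> 1 - q"
proof -
  have ne: "U \<noteq> {}" using U by auto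
  have "q * 1 = (\<Sum>j\<in>U. q * softmax U e j)"
    using sum_softmax[OF U(1) ne] by (simp flip: sum_distrib_left)
  also have "\<dots> \<le> (\<Sum>j\<in>U. (softmax U e j)\<^sup>2)"
    unfolding power2_eq_square by (intro sum_mono mult_right_mono q softmax_nonneg)
  finally show "q \<le> (\<Sum>j\<in>U. (softmax U e j)\<^sup>2)" by simp
  have "softmax U e j \<le> 1 - q" if "j \<in> U" for j
  proof -
    obtain r where r: "r \<in> U" "r \<noteq> j"
      using U by (metis card_le_Suc0_iff_eq not_less_eq_eq numeral_2_eq_2 that)
    have "softmax U e j + softmax U e r = (\<Sum>k\<in>{j, r}. softmax U e k)"
      using r by simp
    also have "\<dots> \<le> (\<Sum>k\<in>U. softmax U e k)"
      using r that U softmax_nonneg by (intro sum_mono2) auto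
    finally show ?thesis using sum_softmax[OF U(1) ne] q[OF r(1)] by simp
  qed
  then have "(\<Sum>j\<in>U. (softmax U e j)\<^sup>2) \<le> (\<Sum>j\<in>U. (1 - q) * softmax U e j)"
    unfolding power2_eq_square by (intro sum_mono mult_right_mono softmax_nonneg)
  also have "\<dots> = 1 - q"
    using sum_softmax[OF U(1) ne] by (simp flip: sum_distrib_left)
  finally show "(\<Sum>j\<in>U. (softmax U e j)\<^sup>2) \<le> 1 - q" .
qed

lemma abs_weighted_sum_le_1:
  fixes v y :: "'a \<Rightarrow> real"
  assumes "\<And>j. j \<in> U \<Longrightarrow> 0 \<le> v j" "(\<Sum>j\<in>U. v j) = 1" "\<And>j. j \<in> U \<Longrightarrow> \<bar>y j\<bar> \<le> 1"
  shows "\<bar>\<Sum>j\<in>U. v j * y j\<bar> \<le> 1"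
proof -
  have "\<bar>\<Sum>j\<in>U. v j * y j\<bar> \<le> (\<Sum>j\<in>U. v j * \<bar>y j\<bar>)"
    using assms(1) by (intro order_trans[OF sum_abs] sum_mono) (simp add: abs_mult)
  also have "\<dots> \<le> (\<Sum>j\<in>U. v j)"
    using assms by (intro sum_mono) (simp add: mult_left_le)
  finally show ?thesis using assms by simp
qed

text \<open>Only the mass \<open>1 - v k\<close> away from \<open>k\<close> contributes, and two
  values in [-1, 1] differ by at most 2. It is applied with labels as \<open>y\<close> and also with
  the weights themselves as \<open>y\<close>.\<close>

lemma abs_weighted_sum_diff_le:
  fixes v y :: "'a \<Rightarrow> real"
  assumes "finite U" "k \<in> U" "\<And>j. j \<in> U \<Longrightarrow> 0 \<le> v j" "(\<Sum>j\<in>U. v j) = 1" "\<And>j. j \<in> U \<Longrightarrow> \<bar>y j\<bar> \<le> 1"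
  shows "\<bar>(\<Sum>j\<in>U. v j * y j) - y k\<bar> \<le> 2 * (1 - v k)"
proof -
  have "(\<Sum>j\<in>U. v j * y j) - y k = (\<Sum>j\<in>U. v j * (y j - y k))"
    using assms(4) by (simp add: right_diff_distrib sum_subtractf flip: sum_distrib_right)
  also have "\<dots> = (\<Sum>j\<in>U - {k}. v j * (y j - y k))"
    using assms(1,2) by (subst sum.remove[of _ k]) auto
  also have "\<bar>\<dots>\<bar> \<le> (\<Sum>j\<in>U - {k}. v j * 2)"
  proof (intro order_trans[OF sum_abs] sum_mono)
    fix j assume j: "j \<in> U - {k}"
    then have "\<bar>y j - y k\<bar> \<le> 2" using assms(5)[of j] assms(5)[of k] assms(2) by simp
    then show "\<bar>v j * (y j - y k)\<bar> \<le> v j * 2"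
      using assms(3)[of j] j by (simp add: abs_mult mult_left_mono)
  qed
  also have "\<dots> = 2 * (1 - v k)"
    using assms(4) sum.remove[OF assms(1,2), of v] by (simp flip: sum_distrib_right)
  finally show ?thesis .
qed

lemma abs_square_diff_le:
  fixes x y :: real
  assumes "\<bar>x\<bar> \<le> 1" "\<bar>y\<bar> \<le> 1"
  shows "\<bar>x\<^sup>2 - y\<^sup>2\<bar> \<le> 2 * \<bar>x - y\<bar>"
proof -
  have "x\<^sup>2 - y\<^sup>2 = (x + y) * (x - y)" by (simp add: power2_eq_square algebra_simps)
  moreover have "\<bar>x + y\<bar> \<le> 2" using assms by simp
  ultimately show ?thesis by (simp add: abs_mult mult_right_mono)
qed

lemma square_le_1: "\<bar>x\<bar> \<le> 1 \<Longrightarrow> \<bar>x\<^sup>2\<bar> \<le> 1" for x :: real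
  by (simp add: abs_square_le_1)

section \<open>Gaussian noise\<close>

text \<open>Measurability is not assumed, so that the bound holds for partial integrals at every
  point, also outside the product space, as the induction in \<open>noise_shift_le\<close>
  demands.\<close>

lemma (in prob_space) abs_expectation_le:
  fixes f :: "'a \<Rightarrow> real"
  assumes "\<And>x. \<bar>f x\<bar> \<le> B"
  shows "\<bar>expectation f\<bar> \<le> B"
proof (cases "integrable M f")
  case True
  have "\<bar>expectation f\<bar> \<le> expectation (\<lambda>x. \<bar>f x\<bar>)"
    by (rule integral_abs_bound)
  also have "\<dots> \<le> B"
    using True assms by (intro integral_le_const) auto
  finally show ?thesis .
next
  case False
  \<comment> \<open>The integral of a non-integrable function is 0, and the bound at an arbitrary
    point shows that \<open>B\<close> is nonnegative.\<close>
  then show ?thesis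
    using assms[of undefined] by (simp add: not_integrable_integral_eq)
qed

lemma (in prob_space) abs_expectation_diff_le:
  fixes X Y :: "'a \<Rightarrow> real"
  assumes X: "integrable M X" and Y: "integrable M Y" and le: "AE x in M. \<bar>X x - Y x\<bar> \<le> r"
  shows "\<bar>expectation X - expectation Y\<bar> \<le> r"
proof -
  have "\<bar>expectation X - expectation Y\<bar> = \<bar>expectation (\<lambda>x. X x - Y x)\<bar>"
    using X Y by simp
  also have "\<dots> \<le> expectation (\<lambda>x. \<bar>X x - Y x\<bar>)"
    by (rule integral_abs_bound)
  also have "\<dots> \<le> r"
    using X Y le by (intro integral_le_const) auto
  finally show ?thesis .
qed

definition std_gaussian_density :: "real^('d::finite) \<Rightarrow> real" where
  "std_gaussian_density x = (\<Prod>l\<in>UNIV. std_normal_density (x $ l))"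

lemma std_gaussian_density_nonneg [simp]: "0 \<le> std_gaussian_density x"
  unfolding std_gaussian_density_def by (intro prod_nonneg) auto

lemma std_gaussian_density_measurable [measurable]: "std_gaussian_density \<in> borel_measurable borel"
  unfolding std_gaussian_density_def by measurable

lemma std_gaussian_eq: "std_gaussian = density lborel (\<lambda>x. ennreal (std_gaussian_density x))"
  unfolding std_gaussian_def std_gaussian_density_def ..

lemma sets_std_gaussian [simp, measurable_cong]: "sets std_gaussian = sets borel"
  by (simp add: std_gaussian_eq)

lemma measurable_std_gaussian [simp]:
  "M \<rightarrow>\<^sub>M std_gaussian = M \<rightarrow>\<^sub>M borel" "std_gaussian \<rightarrow>\<^sub>M M = borel \<rightarrow>\<^sub>M M"
  by (intro measurable_cong_sets; simp)+

lemma nn_integral_std_gaussian_density: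
  "(\<integral>\<^sup>+x. ennreal (std_gaussian_density (x :: real^'d::finite)) \<partial>lborel) = 1"
proof -
  \<comment> \<open>The product over coordinates is rewritten as a product over
    \<open>Basis\<close>, the index set of the factorization rule for \<open>lborel\<close>.\<close>
  have B: "(Basis :: (real^'d) set) = range (\<lambda>l. axis l 1)"
    by (auto simp: Basis_vec_def)
  have inj: "inj (\<lambda>l::'d. axis l (1::real))"
    by (auto intro!: injI simp: axis_eq_axis)
  have "ennreal (std_gaussian_density x) = (\<Prod>b\<in>Basis. ennreal (std_normal_density (x \<bullet> b)))" for x :: "real^'d"
    unfolding std_gaussian_density_def B
    by (subst prod.reindex[OF inj]) (simp add: inner_axis prod_ennreal)
  then have "(\<integral>\<^sup>+x. ennreal (std_gaussian_density (x :: real^'d)) \<partial>lborel)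
      = (\<Prod>b\<in>(Basis :: (real^'d) set). (\<integral>\<^sup>+x. ennreal (std_normal_density x) \<partial>lborel))"
    by (subst nn_integral_lborel_prod[symmetric]) auto
  also have "(\<integral>\<^sup>+x. ennreal (std_normal_density x) \<partial>lborel) = 1"
    using prob_space.emeasure_space_1[OF prob_space_normal_density[of 1 0]]
    by (simp add: emeasure_density)
  finally show ?thesis by simp
qed

lemma prob_space_std_gaussian: "prob_space std_gaussian"
  by (rule prob_spaceI) (simp add: std_gaussian_eq emeasure_density nn_integral_std_gaussian_density)

lemma integrable_std_gaussian_density: "integrable lborel std_gaussian_density"
  by (subst integrable_iff_bounded) (simp add: nn_integral_std_gaussian_density)

interpretation std_gaussian: prob_space "std_gaussian :: (real^'d::finite) measure"
  by (rule prob_space_std_gaussian)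

interpretation gaussian_noise: product_prob_space "\<lambda>_::nat. std_gaussian :: (real^'d::finite) measure" UNIV
  ..

text \<open>Twice the total variation distance between the standard Gaussian and its translate by \<open>t\<close>.\<close>

definition gaussian_shift :: "real^('d::finite) \<Rightarrow> real" where
  "gaussian_shift t = (\<integral>x. \<bar>std_gaussian_density (x - t) - std_gaussian_density x\<bar> \<partial>lborel)"

lemma gaussian_shift_nonneg: "0 \<le> gaussian_shift t"
  unfolding gaussian_shift_def by simp

lemma integral_lborel_shift:
  fixes f :: "'a::euclidean_space \<Rightarrow> real"
  assumes [measurable]: "f \<in> borel_measurable borel"
  shows "(\<integral>x. f (x + t) \<partial>lborel) = (\<integral>x. f x \<partial>lborel)"
proof -
  have "(\<integral>x. f x \<partial>lborel) = (\<integral>x. f x \<partial>distr lborel borel ((+) t))"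
    by (simp add: lborel_distr_plus)
  also have "\<dots> = (\<integral>x. f (t + x) \<partial>lborel)"
    by (rule integral_distr) auto
  finally show ?thesis by (simp add: add.commute)
qed

lemma nn_integral_lborel_shift:
  fixes f :: "'a::euclidean_space \<Rightarrow> ennreal"
  assumes [measurable]: "f \<in> borel_measurable borel"
  shows "(\<integral>\<^sup>+x. f (x - t) \<partial>lborel) = (\<integral>\<^sup>+x. f x \<partial>lborel)"
proof -
  have "(\<integral>\<^sup>+x. f x \<partial>lborel) = (\<integral>\<^sup>+x. f x \<partial>distr lborel borel ((+) (- t)))"
    by (simp add: lborel_distr_plus)
  also have "\<dots> = (\<integral>\<^sup>+x. f (- t + x) \<partial>lborel)"
    by (rule nn_integral_distr) auto
  finally show ?thesis by simp
qed

lemma integrable_std_gaussian_density_shift: "integrable lborel (\<lambda>x. std_gaussian_density (x - t))"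
  by (subst integrable_iff_bounded)
     (simp add: nn_integral_lborel_shift[of "\<lambda>x. ennreal (std_gaussian_density x)"]
        nn_integral_std_gaussian_density)

text \<open>Translation invariance of Lebesgue measure moves the shift from the test function to the
  density.\<close>

lemma std_gaussian_shift_le:
  fixes f :: "real^('d::finite) \<Rightarrow> real"
  assumes [measurable]: "f \<in> borel_measurable borel" and bnd: "\<And>x. \<bar>f x\<bar> \<le> 1"
  shows "\<bar>(\<integral>x. f (x + t) \<partial>std_gaussian) - (\<integral>x. f x \<partial>std_gaussian)\<bar> \<le> gaussian_shift t"
proof -
  let ?p = std_gaussian_density
  have I: "integrable lborel (\<lambda>x. g x * f x)"
    if "integrable lborel g" for g :: "real^'d \<Rightarrow> real"
    using that bnd
    by (intro Bochner_Integration.integrable_bound[OF that]) (auto simp: abs_mult mult_left_le)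
  have "(\<integral>x. f (x + t) \<partial>std_gaussian) = (\<integral>x. ?p (x + t - t) * f (x + t) \<partial>lborel)"
    unfolding std_gaussian_eq by (subst integral_density) auto
  also have "\<dots> = (\<integral>x. ?p (x - t) * f x \<partial>lborel)"
    by (rule integral_lborel_shift) auto
  finally have 1: "(\<integral>x. f (x + t) \<partial>std_gaussian) = (\<integral>x. ?p (x - t) * f x \<partial>lborel)" .
  have 2: "(\<integral>x. f x \<partial>std_gaussian) = (\<integral>x. ?p x * f x \<partial>lborel)"
    unfolding std_gaussian_eq by (subst integral_density) auto
  have "(\<integral>x. f (x + t) \<partial>std_gaussian) - (\<integral>x. f x \<partial>std_gaussian)
      = (\<integral>x. ?p (x - t) * f x - ?p x * f x \<partial>lborel)"
    unfolding 1 2 by (subst Bochner_Integration.integral_diff)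
      (auto intro!: I integrable_std_gaussian_density integrable_std_gaussian_density_shift)
  also have "\<bar>\<dots>\<bar> \<le> (\<integral>x. \<bar>?p (x - t) * f x - ?p x * f x\<bar> \<partial>lborel)"
    by (rule integral_abs_bound)
  also have "\<dots> \<le> gaussian_shift t"
    unfolding gaussian_shift_def
  proof (rule integral_mono)
    fix x :: "real^'d"
    show "\<bar>?p (x - t) * f x - ?p x * f x\<bar> \<le> \<bar>?p (x - t) - ?p x\<bar>"
      using bnd[of x] by (simp add: abs_mult mult_left_le flip: left_diff_distrib)
  qed (auto intro!: I integrable_std_gaussian_density integrable_std_gaussian_density_shift
         Bochner_Integration.integrable_diff integrable_abs)
  finally show ?thesis .
qed

text \<open>Scheffe: the translated densities converge pointwise by continuity and all have the same
  integral, so they converge in the mean. Scheffe's lemma concerns sequences, hence the passage to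
  arbitrary sequences tending to infinity.\<close>

lemma gaussian_shift_tendsto_0:
  fixes t :: "real^'d::finite"
  shows "((\<lambda>\<sigma>. gaussian_shift (inverse \<sigma> *\<^sub>R t)) \<longlongrightarrow> 0) at_top"
proof (rule tendsto_at_topI_sequentially)
  fix X :: "nat \<Rightarrow> real" assume X: "filterlim X at_top sequentially"
  let ?p = std_gaussian_density
  let ?F = "\<lambda>k x. ?p (x - inverse (X k) *\<^sub>R t)"
  have lim: "(\<lambda>k. inverse (X k)) \<longlonglongrightarrow> 0"
    using X by (rule tendsto_inverse_0_at_top)
  have "(\<lambda>k. \<integral>\<^sup>+ x. norm (?F k x - ?p x) \<partial>lborel) \<longlonglongrightarrow> 0"
  proof (rule Scheffe_lemma2)
    show "AE x in lborel. (\<lambda>k. ?F k x) \<longlonglongrightarrow> ?p x"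
    proof (rule AE_I2)
      fix x :: "real^'d"
      have "(\<lambda>k. x - inverse (X k) *\<^sub>R t) \<longlonglongrightarrow> x - 0 *\<^sub>R t"
        by (intro tendsto_intros lim)
      then have *: "(\<lambda>k. x $ l - inverse (X k) * t $ l) \<longlonglongrightarrow> x $ l" for l
        using tendsto_vec_nth[of _ _ _ l] by fastforce
      have "(\<lambda>k. std_normal_density (x $ l - inverse (X k) * t $ l)) \<longlonglongrightarrow> std_normal_density (x $ l)" for l
        unfolding std_normal_density_def by (intro tendsto_intros *) simp
      then show "(\<lambda>k. ?F k x) \<longlonglongrightarrow> ?p x"
        unfolding std_gaussian_density_def by (auto intro!: tendsto_prod)
    qed
  qed (auto simp: integrable_std_gaussian_density
          nn_integral_lborel_shift[of "\<lambda>x. ennreal (std_gaussian_density x)"])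
  then have "(\<lambda>k. enn2real (\<integral>\<^sup>+ x. norm (?F k x - ?p x) \<partial>lborel)) \<longlonglongrightarrow> enn2real 0"
    by (intro tendsto_enn2real) auto
  then show "(\<lambda>k. gaussian_shift (inverse (X k) *\<^sub>R t)) \<longlonglongrightarrow> 0"
    unfolding gaussian_shift_def by (subst integral_eq_nn_integral) auto
qed

abbreviation noise_space :: "nat set \<Rightarrow> (nat \<Rightarrow> real^'d::finite) measure" where
  "noise_space I \<equiv> \<Pi>\<^sub>M j\<in>I. std_gaussian"

lemma noise_component_measurable:
  "l \<in> I \<Longrightarrow> (\<lambda>x. x l) \<in> borel_measurable (noise_space I)"
  using measurable_component_singleton[of l I "\<lambda>_. std_gaussian"] by simp

lemma prob_space_noise: "prob_space (noise_space I)"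
  by (intro prob_space_PiM prob_space_std_gaussian)

text \<open>The coordinates are shifted one at a time; each shift costs its one-vector bound, and
  the triangle inequality adds the costs.\<close>

lemma noise_shift_le:
  fixes f :: "(nat \<Rightarrow> real^('d::finite)) \<Rightarrow> real"
  assumes "finite I" "f \<in> borel_measurable (noise_space I)" "\<And>x. \<bar>f x\<bar> \<le> 1"
  shows "\<bar>(\<integral>x. f (\<lambda>j\<in>I. x j + t j) \<partial>noise_space I) - (\<integral>x. f x \<partial>noise_space I)\<bar>
    \<le> (\<Sum>j\<in>I. gaussian_shift (t j))"
  using assms
proof (induction I arbitrary: f rule: finite_induct)
  case empty
  \<comment> \<open>The empty product space has a single point, the function that is
    \<open>undefined\<close> everywhere, and the restriction returns it.\<close>
  have "(\<integral>x. f (\<lambda>j\<in>{}. x j + t j) \<partial>noise_space {}) = (\<integral>x. f x \<partial>noise_space {})"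
    by (rule Bochner_Integration.integral_cong) (auto simp: space_PiM_empty restrict_def)
  then show ?case by (simp only: sum.empty diff_self abs_zero order_refl)
next
  case (insert i I)
  note [measurable] = insert.prems(1)
  interpret P: prob_space "noise_space J :: (nat \<Rightarrow> real^'d) measure" for J :: "nat set"
    by (rule prob_space_noise)
  have upd [measurable]: "(\<lambda>(x, y :: real^'d). x(i := y)) \<in> noise_space I \<Otimes>\<^sub>M std_gaussian \<rightarrow>\<^sub>M noise_space (insert i I)"
    by (rule measurable_add_dim)
  have fu [measurable]: "(\<lambda>(x, y). f (x(i := y))) \<in> borel_measurable (noise_space I \<Otimes>\<^sub>M std_gaussian)"
    using measurable_compose[OF upd insert.prems(1)] by (simp add: case_prod_unfold)
  have fus [measurable]: "(\<lambda>(x, y). f (x(i := y + t i))) \<in> borel_measurable (noise_space I \<Otimes>\<^sub>M std_gaussian)"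
  proof -
    have "(\<lambda>z. snd z + t i) \<in> noise_space I \<Otimes>\<^sub>M std_gaussian \<rightarrow>\<^sub>M std_gaussian"
      by simp
    from measurable_compose[OF measurable_Pair[OF measurable_fst this] fu]
    show ?thesis by (simp add: case_prod_unfold)
  qed
  have sh [measurable]: "(\<lambda>x. \<lambda>j\<in>J. x j + t j :: real^'d) \<in> noise_space J \<rightarrow>\<^sub>M noise_space J" for J
    by (intro measurable_restrict) simp
  \<comment> \<open>Coordinate \<open>i\<close> is integrated out, without its shift in
    \<open>F\<close> and with it in \<open>F'\<close>. The two differ by the cost of coordinate
    \<open>i\<close>; the induction hypothesis then treats the remaining shifts in
    \<open>F\<close>.\<close>
  define F where "F x = (\<integral>y. f (x(i := y)) \<partial>std_gaussian)" for x
  define F' where "F' x = (\<integral>y. f (x(i := y + t i)) \<partial>std_gaussian)" for x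
  have F_meas [measurable]: "F \<in> borel_measurable (noise_space I)"
    unfolding F_def using fu by (intro std_gaussian.borel_measurable_lebesgue_integral)
  have F'_meas [measurable]: "F' \<in> borel_measurable (noise_space I)"
    unfolding F'_def using fus by (intro std_gaussian.borel_measurable_lebesgue_integral)
  have section_meas: "(\<lambda>y. f (x(i := y))) \<in> borel_measurable borel" if "x \<in> space (noise_space I)" for x
    using measurable_compose[OF measurable_Pair1'[OF that] fu] by simp
  have F_bnd: "\<bar>F x\<bar> \<le> 1" "\<bar>F' x\<bar> \<le> 1" for x
  proof -
    show "\<bar>F x\<bar> \<le> 1" "\<bar>F' x\<bar> \<le> 1"
      unfolding F_def F'_def by (auto intro!: std_gaussian.abs_expectation_le insert.prems)
  qed
  have int: "integrable (noise_space J) g"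
    if "g \<in> borel_measurable (noise_space J)" "\<And>x. \<bar>g x\<bar> \<le> 1" for J and g :: "(nat \<Rightarrow> real^'d) \<Rightarrow> real"
    using that by (intro P.integrable_const_bound[where B = 1]) auto
  have FF': "\<bar>F' x - F x\<bar> \<le> gaussian_shift (t i)" if "x \<in> space (noise_space I)" for x
    unfolding F_def F'_def
    by (rule std_gaussian_shift_le) (use section_meas[OF that] insert.prems in auto)
  have "(\<integral>x. f (\<lambda>j\<in>insert i I. x j + t j) \<partial>noise_space (insert i I))
      = (\<integral>x. (\<integral>y. f (\<lambda>j\<in>insert i I. (x(i := y)) j + t j) \<partial>std_gaussian) \<partial>noise_space I)"
    using insert by (intro gaussian_noise.product_integral_insert int) auto
  also have "\<dots> = (\<integral>x. F' (\<lambda>j\<in>I. x j + t j) \<partial>noise_space I)"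
  proof (intro Bochner_Integration.integral_cong refl)
    fix x
    have "(\<lambda>j\<in>insert i I. (x(i := y)) j + t j) = (\<lambda>j\<in>I. x j + t j)(i := y + t i)" for y
      using insert.hyps by (auto simp: fun_eq_iff)
    then show "(\<integral>y. f (\<lambda>j\<in>insert i I. (x(i := y)) j + t j) \<partial>std_gaussian) = F' (\<lambda>j\<in>I. x j + t j)"
      unfolding F'_def by simp
  qed
  finally have 1: "(\<integral>x. f (\<lambda>j\<in>insert i I. x j + t j) \<partial>noise_space (insert i I))
      = (\<integral>x. F' (\<lambda>j\<in>I. x j + t j) \<partial>noise_space I)" .
  have 2: "(\<integral>x. f x \<partial>noise_space (insert i I)) = (\<integral>x. F x \<partial>noise_space I)"
    unfolding F_def using insert by (intro gaussian_noise.product_integral_insert int) auto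
  have "\<bar>(\<integral>x. F' (\<lambda>j\<in>I. x j + t j) \<partial>noise_space I) - (\<integral>x. F (\<lambda>j\<in>I. x j + t j) \<partial>noise_space I)\<bar>
      = \<bar>\<integral>x. F' (\<lambda>j\<in>I. x j + t j) - F (\<lambda>j\<in>I. x j + t j) \<partial>noise_space I\<bar>"
    by (subst Bochner_Integration.integral_diff) (auto intro!: int F_bnd)
  also have "\<dots> \<le> (\<integral>x. \<bar>F' (\<lambda>j\<in>I. x j + t j) - F (\<lambda>j\<in>I. x j + t j)\<bar> \<partial>noise_space I)"
    by (rule integral_abs_bound)
  also have "\<dots> \<le> gaussian_shift (t i)"
  proof (rule P.integral_le_const)
    show "AE x in noise_space I. \<bar>F' (\<lambda>j\<in>I. x j + t j) - F (\<lambda>j\<in>I. x j + t j)\<bar> \<le> gaussian_shift (t i)"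
      by (intro AE_I2 FF' measurable_space[OF sh])
  qed (auto intro!: int F_bnd integrable_abs Bochner_Integration.integrable_diff)
  finally have 3: "\<bar>(\<integral>x. F' (\<lambda>j\<in>I. x j + t j) \<partial>noise_space I)
      - (\<integral>x. F (\<lambda>j\<in>I. x j + t j) \<partial>noise_space I)\<bar> \<le> gaussian_shift (t i)" .
  have "\<bar>(\<integral>x. F (\<lambda>j\<in>I. x j + t j) \<partial>noise_space I) - (\<integral>x. F x \<partial>noise_space I)\<bar>
      \<le> (\<Sum>j\<in>I. gaussian_shift (t j))"
    by (intro insert.IH F_bnd F_meas)
  then show ?case
    unfolding 1 2 using 3 insert.hyps by simp
qed

section \<open>Weighted l1 distance and the absence of ties\<close>

definition wl1 :: "real^('d::finite) \<Rightarrow> real^'d \<Rightarrow> real^'d \<Rightarrow> real" where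
  "wl1 w u v = (\<Sum>l\<in>UNIV. w $ l * \<bar>u $ l - v $ l\<bar>)"

lemma wl1_measurable [measurable (raw)]:
  assumes [measurable]: "f \<in> borel_measurable M" "g \<in> borel_measurable M"
  shows "(\<lambda>x. wl1 w (f x) (g x)) \<in> borel_measurable M"
proof -
  have [measurable]: "(\<lambda>x. f x $ l) \<in> borel_measurable M" "(\<lambda>x. g x $ l) \<in> borel_measurable M" for l
    using assms by (auto intro: measurable_compose[OF _ borel_measurable_nth])
  show ?thesis unfolding wl1_def by measurable
qed

text \<open>The sphere lies in the frontier of the convex ball: moving away from the centre along a coordinate leaves the ball.\<close>

lemma negligible_wl1_sphere:
  fixes w u :: "real^('d::finite)"
  assumes w: "\<forall>l. 0 < w $ l"
  shows "negligible {z. wl1 w u z = r}"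
proof (rule negligible_subset[OF negligible_convex_frontier])
  define S where "S = {z. wl1 w u z \<le> r}"
  show "convex S"
  proof (rule convexI)
    fix x y :: "real^'d" and p q :: real
    assume xy: "x \<in> S" "y \<in> S" and pq: "0 \<le> p" "0 \<le> q" "p + q = 1"
    have "\<bar>u $ l - (p *\<^sub>R x + q *\<^sub>R y) $ l\<bar> \<le> p * \<bar>u $ l - x $ l\<bar> + q * \<bar>u $ l - y $ l\<bar>" for l
    proof -
      have "u $ l - (p *\<^sub>R x + q *\<^sub>R y) $ l = (p + q) * u $ l - (p * x $ l + q * y $ l)"
        using pq by simp
      also have "\<dots> = p * (u $ l - x $ l) + q * (u $ l - y $ l)"
        by (simp add: algebra_simps)
      also have "\<bar>\<dots>\<bar> \<le> \<bar>p * (u $ l - x $ l)\<bar> + \<bar>q * (u $ l - y $ l)\<bar>"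
        by (rule abs_triangle_ineq)
      finally show ?thesis using pq by (simp add: abs_mult)
    qed
    then have "wl1 w u (p *\<^sub>R x + q *\<^sub>R y)
        \<le> (\<Sum>l\<in>UNIV. w $ l * (p * \<bar>u $ l - x $ l\<bar> + q * \<bar>u $ l - y $ l\<bar>))"
      unfolding wl1_def using w by (intro sum_mono mult_left_mono) (auto simp: less_imp_le)
    also have "\<dots> = p * wl1 w u x + q * wl1 w u y"
      unfolding wl1_def by (simp add: sum_distrib_left sum.distrib algebra_simps)
    also have "\<dots> \<le> p * r + q * r"
      using xy pq unfolding S_def by (intro add_mono mult_left_mono) auto
    also have "\<dots> = r" using pq by (simp flip: distrib_right)
    finally show "p *\<^sub>R x + q *\<^sub>R y \<in> S" unfolding S_def by simp
  qed
  show "{z. wl1 w u z = r} \<subseteq> frontier S"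
  proof safe
    fix z assume r: "r = wl1 w u z"
    have "z \<notin> interior S"
    proof
      assume "z \<in> interior S"
      then obtain e where e: "e > 0" "ball z e \<subseteq> S"
        by (auto simp: mem_interior)
      \<comment> \<open>Any coordinate will do; one exists because types are inhabited.\<close>
      obtain k :: 'd where True by simp
      \<comment> \<open>The sign pushes coordinate \<open>k\<close> away from \<open>u\<close>; half
        the radius stays inside the open ball.\<close>
      define s where "s = (if u $ k \<le> z $ k then e / 2 else - (e / 2))"
      define z' where "z' = z + s *\<^sub>R axis k 1"
      have "z' \<in> ball z e"
        using e(1) unfolding z'_def s_def by (auto simp: dist_norm)
      then have "wl1 w u z' \<le> wl1 w u z"
        using e(2) r unfolding S_def by auto
      moreover have "wl1 w u z < wl1 w u z'"
        unfolding wl1_def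
      proof (rule sum_strict_mono_ex1)
        show "\<forall>l\<in>UNIV. w $ l * \<bar>u $ l - z $ l\<bar> \<le> w $ l * \<bar>u $ l - z' $ l\<bar>"
          using w e(1) by (auto intro!: mult_left_mono simp: less_imp_le z'_def s_def axis_def)
        show "\<exists>l\<in>UNIV. w $ l * \<bar>u $ l - z $ l\<bar> < w $ l * \<bar>u $ l - z' $ l\<bar>"
          using w e(1) by (intro bexI[of _ k]) (auto simp: z'_def s_def axis_def)
      qed simp
      ultimately show False by simp
    qed
    then show "z \<in> frontier S"
      using closure_subset[of S] unfolding frontier_def S_def by (auto simp: r)
  qed
qed

text \<open>Once all vectors except \<open>x j\<close> are fixed, a tie places \<open>x j\<close> on
  a fixed sphere around \<open>x i\<close>, a null set for the Gaussian density.\<close>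

lemma AE_noise_wl1_neq:
  fixes w :: "real^('d::finite)"
  assumes w: "\<forall>l. 0 < w $ l" and I: "finite I" "i \<in> I" "j \<in> I" "k \<in> I" "i \<noteq> j" "k \<noteq> j"
  shows "AE x in noise_space I. wl1 w (x i) (x j) \<noteq> wl1 w (x i) (x k)"
proof -
  have AE1: "AE z in std_gaussian. wl1 w u z \<noteq> r" for u r
  proof -
    have "AE z in lborel. wl1 w u z \<noteq> r"
    proof -
      have "{z. wl1 w u z = r} \<in> sets lborel" by measurable
      then have "{z. wl1 w u z = r} \<in> null_sets lborel"
        using negligible_wl1_sphere[OF w, of u r]
        by (simp add: negligible_iff_null_sets null_sets_completion_iff)
      then show ?thesis by (auto dest: AE_not_in)
    qed
    then show ?thesis
      unfolding std_gaussian_eq by (subst AE_density) auto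
  qed
  define J where "J = I - {j}"
  have J: "I = insert j J" "j \<notin> J" "finite J" "i \<in> J" "k \<in> J"
    using I by (auto simp: J_def)
  note noise_component_measurable [measurable]
  let ?N = "{x \<in> space (noise_space I). wl1 w (x i) (x j) = wl1 w (x i) (x k)}"
  have N [measurable]: "?N \<in> sets (noise_space I)"
    using I by measurable
  have "emeasure (noise_space I) ?N = (\<integral>\<^sup>+x. indicator ?N x \<partial>noise_space I)"
    by simp
  also have "\<dots> = (\<integral>\<^sup>+x. (\<integral>\<^sup>+y. indicator ?N (x(j := y)) \<partial>std_gaussian) \<partial>noise_space J)"
    unfolding J(1) using J N by (intro gaussian_noise.product_nn_integral_insert) auto
  also have "\<dots> = (\<integral>\<^sup>+x. 0 \<partial>(noise_space J :: (nat \<Rightarrow> real^'d) measure))"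
  proof (intro nn_integral_cong)
    fix x :: "nat \<Rightarrow> real^'d"
    have "(\<integral>\<^sup>+y. indicator ?N (x(j := y)) \<partial>std_gaussian) = (\<integral>\<^sup>+y. 0 \<partial>(std_gaussian :: (real^'d) measure))"
    proof (rule nn_integral_cong_AE)
      show "AE y in std_gaussian. indicator ?N (x(j := y)) = (0::ennreal)"
        using AE1[of "x i" "wl1 w (x i) (x k)"] by eventually_elim (use I in auto)
    qed
    then show "(\<integral>\<^sup>+y. indicator ?N (x(j := y)) \<partial>std_gaussian) = 0" by simp
  qed
  finally have "emeasure (noise_space I) ?N = 0" by simp
  then show ?thesis
    by (intro AE_I[of _ _ ?N]) auto
qed

section \<open>Law of the neighbourhood and its labels\<close>

text \<open>The neighbourhood depends only on the discrete part of an outcome, so that conditioning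
  on it can be carried out inside the pmf.\<close>

definition graph_nbhd :: "nat \<Rightarrow> nat \<Rightarrow> (nat \<Rightarrow> real) \<times> nat set set \<Rightarrow> nat set" where
  "graph_nbhd n i g = {j \<in> {..<n} - {i}. {i, j} \<in> snd g}"

lemma nbhd_eq_graph_nbhd: "nbhd n i \<omega> = graph_nbhd n i (fst \<omega>)"
  by (simp add: nbhd_def graph_nbhd_def)

lemma graph_nbhd_subset: "graph_nbhd n i g \<subseteq> {..<n} - {i}"
  by (auto simp: graph_nbhd_def)

lemma finite_graph_nbhd [simp]: "finite (graph_nbhd n i g)"
  by (rule finite_subset[OF graph_nbhd_subset]) simp

lemma expectation_cond_pmf:
  fixes f :: "'a \<Rightarrow> real"
  assumes fin: "finite (set_pmf p)" and ne: "set_pmf p \<inter> s \<noteq> {}"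
  shows "measure_pmf.expectation (cond_pmf p s) f
    = measure_pmf.expectation p (\<lambda>x. of_bool (x \<in> s) * f x) / measure_pmf.prob p s"
proof -
  have "measure_pmf.expectation (cond_pmf p s) f
      = (\<Sum>x\<in>set_pmf p. f x * pmf (cond_pmf p s) x)"
    using fin ne by (intro integral_measure_pmf_real) auto
  also have "\<dots> = (\<Sum>x\<in>set_pmf p. of_bool (x \<in> s) * f x * pmf p x / measure_pmf.prob p s)"
    by (intro sum.cong refl) (simp add: pmf_cond[OF ne])
  also have "\<dots> = (\<Sum>x\<in>set_pmf p. of_bool (x \<in> s) * f x * pmf p x) / measure_pmf.prob p s"
    by (simp add: sum_divide_distrib)
  also have "(\<Sum>x\<in>set_pmf p. of_bool (x \<in> s) * f x * pmf p x)
      = measure_pmf.expectation p (\<lambda>x. of_bool (x \<in> s) * f x)"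
    using fin by (intro integral_measure_pmf_real[symmetric]) auto
  finally show ?thesis .
qed

locale csbm_target =
  fixes n i :: nat and a b :: real
  assumes b_pos: "0 < b" and b_less_a: "b < a" and a_le_n: "a \<le> real n" and i_less_n: "i < n"
begin

abbreviation "labels_pmf \<equiv> Pi_pmf {..<n} (0::real) (\<lambda>_. pmf_of_set {-1, 1})"
abbreviation "all_edges \<equiv> {e. e \<subseteq> {..<n} \<and> card e = 2}"
abbreviation "edges_pmf y \<equiv> Pi_pmf all_edges False
  (\<lambda>e. bernoulli_pmf (if card (y ` e) = 1 then a / real n else b / real n))"
abbreviation "graph_pmf \<equiv> csbm_graph n a b"
abbreviation "m \<equiv> homophily a b"

lemma probs: "0 < a / n" "a / n \<le> 1" "0 < b / n" "b / n < 1"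
  using b_pos b_less_a a_le_n i_less_n by auto

lemma m_bounds: "0 < m" "m < 1"
  using b_pos b_less_a by (auto simp: homophily_def)

lemma finite_all_edges [simp]: "finite all_edges"
  by (rule finite_subset[of _ "Pow {..<n}"]) auto

lemma finite_set_labels_pmf: "finite (set_pmf labels_pmf)"
  by (subst set_Pi_pmf) (auto intro!: finite_PiE_dflt)

lemma finite_set_edges_pmf: "finite (set_pmf (edges_pmf y))"
  by (subst set_Pi_pmf) (auto intro!: finite_PiE_dflt)

lemma graph_pmf_eq: "graph_pmf = bind_pmf labels_pmf (\<lambda>y. map_pmf (\<lambda>X. (y, {e. X e})) (edges_pmf y))"
  unfolding csbm_graph_def map_pmf_def by simp

lemma finite_set_graph_pmf: "finite (set_pmf graph_pmf)"
  unfolding graph_pmf_eq using finite_set_labels_pmf finite_set_edges_pmf by auto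

lemma label_cases:
  assumes "g \<in> set_pmf graph_pmf" "j < n"
  shows "fst g j \<in> {-1, 1}"
  using assms unfolding graph_pmf_eq by (auto simp: set_Pi_pmf PiE_dflt_def)

text \<open>
  For \<open>j \<noteq> i\<close>, the probability that \<open>j\<close> is adjacent to \<open>i\<close> exactly if \<open>j \<in> S\<close>, given \<open>y\<^sub>i = c\<close> and \<open>y\<^sub>j = v\<close>;
  the factor at \<open>i\<close> itself encodes the condition \<open>y\<^sub>i = c\<close>.
\<close>

definition neighbour_weight :: "nat set \<Rightarrow> real \<Rightarrow> nat \<Rightarrow> real \<Rightarrow> real" where
  "neighbour_weight S c j v =
     (if j = i then of_bool (v = c)
      else if j \<in> S then (if v = c then a / n else b / n)
      else 1 - (if v = c then a / n else b / n))"

lemma neighbour_weight_nonneg: "0 \<le> neighbour_weight S c j v"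
  using probs by (auto simp: neighbour_weight_def)

text \<open>The event constrains only the edges at \<open>i\<close>, and these are independent given
  the labels.\<close>

lemma prob_nbhd_given_labels:
  assumes S: "S \<subseteq> {..<n} - {i}" and yi: "y i = c"
  shows "measure_pmf.prob (edges_pmf y) {X. graph_nbhd n i (y, {e. X e}) = S}
    = (\<Prod>j\<in>{..<n} - {i}. neighbour_weight S c j (y j))"
proof -
  \<comment> \<open>\<open>B e\<close> collects the admissible values of edge \<open>e\<close>: a
    single value if \<open>e\<close> contains \<open>i\<close>, both otherwise. The event is thus a
    box, and its probability a product.\<close>
  define B where "B e = {x. \<forall>j\<in>{..<n} - {i}. e = {i, j} \<longrightarrow> (x \<longleftrightarrow> j \<in> S)}" for e :: "nat set"
  let ?q = "\<lambda>e. bernoulli_pmf (if card (y ` e) = 1 then a / real n else b / real n)"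
  let ?I = "(\<lambda>j. {i, j}) ` ({..<n} - {i})"
  have IE: "?I \<subseteq> all_edges" using i_less_n by auto
  have inj: "inj_on (\<lambda>j. {i, j}) ({..<n} - {i})"
    by (auto intro!: inj_onI simp: doubleton_eq_iff)
  have "{X. graph_nbhd n i (y, {e. X e}) = S} = Pi all_edges B"
  proof (intro set_eqI iffI)
    fix X assume "X \<in> {X. graph_nbhd n i (y, {e. X e}) = S}"
    then show "X \<in> Pi all_edges B"
      by (auto simp: B_def graph_nbhd_def)
  next
    fix X assume X: "X \<in> Pi all_edges B"
    have "X {i, j} \<longleftrightarrow> j \<in> S" if "j \<in> {..<n} - {i}" for j
    proof -
      have "{i, j} \<in> all_edges" using that IE by blast
      with X have "X {i, j} \<in> B {i, j}" by blast
      then show ?thesis using that unfolding B_def by blast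
    qed
    then show "X \<in> {X. graph_nbhd n i (y, {e. X e}) = S}"
      using S by (auto simp: graph_nbhd_def)
  qed
  then have "measure_pmf.prob (edges_pmf y) {X. graph_nbhd n i (y, {e. X e}) = S}
      = (\<Prod>e\<in>all_edges. measure_pmf.prob (?q e) (B e))"
    by (simp add: measure_Pi_pmf_Pi)
  also have "\<dots> = (\<Prod>e\<in>?I. measure_pmf.prob (?q e) (B e))"
  proof (rule prod.mono_neutral_right)
    show "\<forall>e\<in>all_edges - ?I. measure_pmf.prob (?q e) (B e) = 1"
    proof
      fix e assume "e \<in> all_edges - ?I"
      then have "B e = UNIV" by (auto simp: B_def)
      then show "measure_pmf.prob (?q e) (B e) = 1" by simp
    qed
  qed (use IE in auto)
  also have "\<dots> = (\<Prod>j\<in>{..<n} - {i}. measure_pmf.prob (?q {i, j}) (B {i, j}))"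
    by (subst prod.reindex[OF inj]) simp
  also have "\<dots> = (\<Prod>j\<in>{..<n} - {i}. neighbour_weight S c j (y j))"
  proof (rule prod.cong[OF refl])
    fix j assume j: "j \<in> {..<n} - {i}"
    have "B {i, j} = {j \<in> S}"
      using j by (auto simp: B_def doubleton_eq_iff)
    moreover have "card (y ` {i, j}) = 1 \<longleftrightarrow> y j = c"
      using yi by (auto simp: card_insert_if)
    ultimately show "measure_pmf.prob (?q {i, j}) (B {i, j}) = neighbour_weight S c j (y j)"
      using j probs by (auto simp: neighbour_weight_def measure_pmf_single)
  qed
  finally show ?thesis .
qed

text \<open>Averaging out the edges turns the event into a product of functions of single labels.
  The labels are independent and uniform, so each factor is averaged over its two values.\<close>

lemma expectation_labels_given_nbhd:
  assumes S: "S \<subseteq> {..<n} - {i}" and h: "\<And>j v. v \<in> {-1, 1} \<Longrightarrow> 0 \<le> h j v"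
  shows "measure_pmf.expectation graph_pmf
      (\<lambda>g. of_bool (fst g i = c \<and> graph_nbhd n i g = S) * (\<Prod>j<n. h j (fst g j)))
    = (\<Prod>j<n. (neighbour_weight S c j (-1) * h j (-1) + neighbour_weight S c j 1 * h j 1) / 2)"
proof -
  have inner: "measure_pmf.expectation (edges_pmf y)
        (\<lambda>X. of_bool (y i = c \<and> graph_nbhd n i (y, {e. X e}) = S) * (\<Prod>j<n. h j (y j)))
      = (\<Prod>j<n. neighbour_weight S c j (y j) * h j (y j))" for y
  proof -
    have "measure_pmf.expectation (edges_pmf y)
        (\<lambda>X. of_bool (y i = c \<and> graph_nbhd n i (y, {e. X e}) = S) * (\<Prod>j<n. h j (y j)))
      = measure_pmf.expectation (edges_pmf y)
        (\<lambda>X. of_bool (y i = c) * (\<Prod>j<n. h j (y j)) * indicator {X. graph_nbhd n i (y, {e. X e}) = S} X)"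
      by (intro Bochner_Integration.integral_cong refl) (auto simp: indicator_def)
    also have "\<dots> = of_bool (y i = c) * (\<Prod>j<n. h j (y j))
        * measure_pmf.prob (edges_pmf y) {X. graph_nbhd n i (y, {e. X e}) = S}"
      by simp
    also have "\<dots> = of_bool (y i = c) * (\<Prod>j<n. h j (y j))
        * (\<Prod>j\<in>{..<n} - {i}. neighbour_weight S c j (y j))"
      using prob_nbhd_given_labels[OF S, of y c] by simp
    also have "\<dots> = (\<Prod>j<n. neighbour_weight S c j (y j)) * (\<Prod>j<n. h j (y j))"
      using i_less_n prod.remove[of "{..<n}" i "\<lambda>j. neighbour_weight S c j (y j)"]
      by (simp add: neighbour_weight_def)
    finally show ?thesis by (simp add: prod.distrib)
  qed
  have "measure_pmf.expectation graph_pmf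
      (\<lambda>g. of_bool (fst g i = c \<and> graph_nbhd n i g = S) * (\<Prod>j<n. h j (fst g j)))
    = (\<Sum>y\<in>set_pmf labels_pmf. pmf labels_pmf y *\<^sub>R (\<Prod>j<n. neighbour_weight S c j (y j) * h j (y j)))"
    unfolding graph_pmf_eq using finite_set_labels_pmf finite_set_edges_pmf
    by (subst pmf_expectation_bind[where A = "set_pmf labels_pmf"])
       (simp_all only: integral_map_pmf fst_conv inner set_map_pmf order_refl, blast)
  also have "\<dots> = measure_pmf.expectation labels_pmf (\<lambda>y. \<Prod>j<n. neighbour_weight S c j (y j) * h j (y j))"
    using finite_set_labels_pmf by (intro integral_measure_pmf[symmetric]) auto
  also have "\<dots> = (\<Prod>j<n. measure_pmf.expectation (pmf_of_set {-1, 1}) (\<lambda>v. neighbour_weight S c j v * h j v))"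
    by (subst expectation_prod_Pi_pmf)
       (auto intro!: integrable_measure_pmf_finite mult_nonneg_nonneg neighbour_weight_nonneg h)
  also have "\<dots> = (\<Prod>j<n. (neighbour_weight S c j (-1) * h j (-1) + neighbour_weight S c j 1 * h j 1) / 2)"
    by (subst integral_pmf_of_set) auto
  finally show ?thesis .
qed

text \<open>Conditioning is meaningful only on events of positive probability. Were the
  configuration impossible, the product formula would yield 0, although each of its factors is
  positive.\<close>

lemma nbhd_labels_possible:
  assumes S: "S \<subseteq> {..<n} - {i}" and c: "c \<in> {-1, 1}" and s: "\<forall>j\<in>S. s j \<in> {-1, 1}"
  shows "\<exists>g\<in>set_pmf graph_pmf. fst g i = c \<and> graph_nbhd n i g = S \<and> (\<forall>j\<in>S. fst g j = s j)"
proof (rule ccontr)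
  assume neg: "\<not> ?thesis"
  define h where "h j v = (if j \<in> S then of_bool (v = s j) else 1 :: real)" for j v
  have "measure_pmf.expectation graph_pmf
      (\<lambda>g. of_bool (fst g i = c \<and> graph_nbhd n i g = S) * (\<Prod>j<n. h j (fst g j)))
    = measure_pmf.expectation graph_pmf (\<lambda>g. 0)"
  proof (intro integral_cong_AE AE_pmfI)
    fix g assume g: "g \<in> set_pmf graph_pmf"
    show "of_bool (fst g i = c \<and> graph_nbhd n i g = S) * (\<Prod>j<n. h j (fst g j)) = 0"
    proof (cases "fst g i = c \<and> graph_nbhd n i g = S")
      case True
      then obtain j where "j \<in> S" "fst g j \<noteq> s j" using neg g by blast
      then have "\<exists>j\<in>{..<n}. h j (fst g j) = 0" using S by (auto simp: h_def)
      then show ?thesis by simp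
    qed simp
  qed auto
  \<comment> \<open>When a = n, a node with label \<open>c\<close> is always adjacent to
    \<open>i\<close>. A non-neighbour still has a positive factor through the other label, because b
    / n < 1.\<close>
  moreover have "0 < (neighbour_weight S c j (-1) * h j (-1) + neighbour_weight S c j 1 * h j 1) / 2" for j
    using S c s i_less_n b_pos b_less_a
    by (auto simp: neighbour_weight_def h_def) (use probs(2,4) in linarith)+
  then have "0 < (\<Prod>j<n. (neighbour_weight S c j (-1) * h j (-1) + neighbour_weight S c j 1 * h j 1) / 2)"
    by (intro prod_pos) simp
  moreover have "0 \<le> h j v" for j v by (simp add: h_def)
  ultimately show False
    using expectation_labels_given_nbhd[OF S, of h c] by (simp del: prod_zero_iff)
qed

abbreviation "nbhd_weight S c \<equiv>
  measure_pmf.expectation graph_pmf (\<lambda>g. of_bool (fst g i = c \<and> graph_nbhd n i g = S))"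

text \<open>
  The product formula for expectations under \<^const>\<open>Pi_pmf\<close> needs nonnegative factors. Labels are
  \<open>\<plusminus>1\<close>, so \<open>1 + y\<^sub>j\<close> qualifies, and the moments of the labels follow by expanding the product.
\<close>

lemma expectation_prod_labels:
  assumes S: "S \<subseteq> {..<n} - {i}" and c: "c \<in> {-1, 1}" and J: "J \<subseteq> S"
  shows "measure_pmf.expectation graph_pmf
      (\<lambda>g. of_bool (fst g i = c \<and> graph_nbhd n i g = S) * (\<Prod>j\<in>J. 1 + fst g j))
    = (1 + m * c) ^ card J * nbhd_weight S c"
proof -
  define h where "h j v = (if j \<in> J then 1 + v else 1 :: real)" for j v
  have J': "J \<subseteq> {..<n}" using S J by auto
  have "(\<Prod>j\<in>J. 1 + fst g j) = (\<Prod>j<n. h j (fst g j))" for g :: "(nat \<Rightarrow> real) \<times> nat set set"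
    using J' unfolding h_def by (subst prod.If_cases) (auto simp: Int_absorb1)
  then have "measure_pmf.expectation graph_pmf
      (\<lambda>g. of_bool (fst g i = c \<and> graph_nbhd n i g = S) * (\<Prod>j\<in>J. 1 + fst g j))
    = (\<Prod>j<n. (neighbour_weight S c j (-1) * h j (-1) + neighbour_weight S c j 1 * h j 1) / 2)"
    by (simp only:, intro expectation_labels_given_nbhd S) (auto simp: h_def)
  \<comment> \<open>By Bayes, a neighbour has label 1 with probability
    \<open>(1 + m * c) / 2\<close>; weighting its two values by \<open>1 + v\<close> therefore
    multiplies its factor by \<open>1 + m * c\<close>.\<close>
  also have "\<dots> = (\<Prod>j<n. (if j \<in> J then 1 + m * c else 1)
      * ((neighbour_weight S c j (-1) * 1 + neighbour_weight S c j 1 * 1) / 2))"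
  proof (rule prod.cong[OF refl])
    fix j assume "j \<in> {..<n}"
    show "(neighbour_weight S c j (-1) * h j (-1) + neighbour_weight S c j 1 * h j 1) / 2
      = (if j \<in> J then 1 + m * c else 1)
        * ((neighbour_weight S c j (-1) * 1 + neighbour_weight S c j 1 * 1) / 2)"
    proof (cases "j \<in> J")
      case True
      then have "j \<in> S" "j \<noteq> i" using S J by auto
      then show ?thesis
        using True c b_pos b_less_a i_less_n
        by (auto simp: h_def neighbour_weight_def homophily_def field_simps)
    qed (simp add: h_def)
  qed
  also have "\<dots> = (\<Prod>j<n. if j \<in> J then 1 + m * c else 1)
      * (\<Prod>j<n. (neighbour_weight S c j (-1) * 1 + neighbour_weight S c j 1 * 1) / 2)"
    by (rule prod.distrib)
  also have "(\<Prod>j<n. (neighbour_weight S c j (-1) * 1 + neighbour_weight S c j 1 * 1) / 2) = nbhd_weight S c"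
    using expectation_labels_given_nbhd[OF S, of "\<lambda>_ _. 1" c] by simp
  also have "(\<Prod>j<n. if j \<in> J then 1 + m * c else 1) = (1 + m * c) ^ card J"
    using J' by (subst prod.If_cases) (auto simp: Int_absorb1)
  finally show ?thesis .
qed

lemma integrable_graph_pmf: "integrable (measure_pmf graph_pmf) (f :: _ \<Rightarrow> real)"
  by (rule integrable_measure_pmf_finite[OF finite_set_graph_pmf])

lemma expectation_label:
  assumes S: "S \<subseteq> {..<n} - {i}" and c: "c \<in> {-1, 1}" and j: "j \<in> S"
  shows "measure_pmf.expectation graph_pmf
      (\<lambda>g. of_bool (fst g i = c \<and> graph_nbhd n i g = S) * fst g j) = m * c * nbhd_weight S c"
  using expectation_prod_labels[OF S c, of "{j}"] j
  by (simp add: distrib_left distrib_right integrable_graph_pmf)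

lemma expectation_label_mult:
  assumes S: "S \<subseteq> {..<n} - {i}" and c: "c \<in> {-1, 1}" and jk: "j \<in> S" "k \<in> S"
  shows "measure_pmf.expectation graph_pmf
      (\<lambda>g. of_bool (fst g i = c \<and> graph_nbhd n i g = S) * (fst g j * fst g k))
    = (if j = k then 1 else m\<^sup>2) * nbhd_weight S c"
proof (cases "j = k")
  case True
  have "measure_pmf.expectation graph_pmf
      (\<lambda>g. of_bool (fst g i = c \<and> graph_nbhd n i g = S) * (fst g j * fst g k)) = nbhd_weight S c"
  proof (intro integral_cong_AE AE_pmfI)
    fix g assume "g \<in> set_pmf graph_pmf"
    then have "fst g j \<in> {-1, 1}" using S jk by (intro label_cases) auto
    then show "of_bool (fst g i = c \<and> graph_nbhd n i g = S) * (fst g j * fst g k)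
        = of_bool (fst g i = c \<and> graph_nbhd n i g = S)"
      using True by auto
  qed auto
  then show ?thesis using True by simp
next
  case False
  let ?E = "\<lambda>f. measure_pmf.expectation graph_pmf (\<lambda>g. of_bool (fst g i = c \<and> graph_nbhd n i g = S) * f g)"
  have "?E (\<lambda>g. \<Prod>j\<in>{j, k}. 1 + fst g j)
      = nbhd_weight S c + ?E (\<lambda>g. fst g j) + ?E (\<lambda>g. fst g k) + ?E (\<lambda>g. fst g j * fst g k)"
    using False by (simp add: distrib_left distrib_right integrable_graph_pmf)
  moreover have "?E (\<lambda>g. \<Prod>j\<in>{j, k}. 1 + fst g j) = (1 + m * c)\<^sup>2 * nbhd_weight S c"
    using expectation_prod_labels[OF S c, of "{j, k}"] jk False by (simp add: power2_eq_square)
  moreover have "c * c = 1" using c by auto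
  then have "(1 + m * c)\<^sup>2 = 1 + 2 * (m * c) + m\<^sup>2"
    by (simp add: power2_eq_square algebra_simps)
  ultimately show ?thesis
    using expectation_label[OF S c jk(1)] expectation_label[OF S c jk(2)] False
    by (simp add: algebra_simps)
qed

end

section \<open>The conditioned model\<close>

text \<open>The event is a cylinder over the graph, so conditioning acts on the pmf and leaves the
  noise law untouched. Agreement on rectangles suffices.\<close>

lemma (in csbm_target) uniform_measure_csbm:
  assumes ne: "set_pmf graph_pmf \<inter> Collect A \<noteq> {}"
  shows "uniform_measure (csbm n a b :: ('d::finite) outcome measure) {\<omega> \<in> space (csbm n a b). A (fst \<omega>)}
    = measure_pmf (cond_pmf graph_pmf (Collect A)) \<Otimes>\<^sub>M noise_space {..<n}"
proof (rule pair_measure_eqI[symmetric])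
  interpret N: prob_space "noise_space {..<n} :: (nat \<Rightarrow> real^'d) measure"
    by (rule prob_space_noise)
  show "sigma_finite_measure (measure_pmf (cond_pmf graph_pmf (Collect A)))"
    by (rule measure_pmf.sigma_finite_measure_axioms)
  show "sigma_finite_measure (noise_space {..<n} :: (nat \<Rightarrow> real^'d) measure)"
    by (rule N.sigma_finite_measure_axioms)
  show "sets (measure_pmf (cond_pmf graph_pmf (Collect A)) \<Otimes>\<^sub>M noise_space {..<n})
      = sets (uniform_measure (csbm n a b :: 'd outcome measure) {\<omega> \<in> space (csbm n a b). A (fst \<omega>)})"
    unfolding sets_uniform_measure csbm_def by (intro sets_pair_measure_cong) simp_all
  let ?N = "noise_space {..<n} :: (nat \<Rightarrow> real^'d) measure"
  have ev: "{\<omega> \<in> space (csbm n a b :: 'd outcome measure). A (fst \<omega>)} = Collect A \<times> space ?N"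
    by (auto simp: csbm_def space_pair_measure)
  fix X and Y :: "(nat \<Rightarrow> real^'d) set"
  assume X: "X \<in> sets (measure_pmf (cond_pmf graph_pmf (Collect A)))" and Y: "Y \<in> sets ?N"
  have int: "(Collect A \<times> space ?N) \<inter> (X \<times> Y) = (Collect A \<inter> X) \<times> Y"
    using sets.sets_into_space[OF Y] by auto
  have G: "emeasure (csbm n a b) (C \<times> Z) = emeasure (measure_pmf graph_pmf) C * emeasure ?N Z"
    if "Z \<in> sets ?N" for C Z
    unfolding csbm_def using that by (intro N.emeasure_pair_measure_Times) auto
  have "emeasure (measure_pmf (cond_pmf graph_pmf (Collect A))) X
      = emeasure (measure_pmf graph_pmf) (Collect A \<inter> X) / emeasure (measure_pmf graph_pmf) (Collect A)"
    by (simp add: cond_pmf.rep_eq[OF ne])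
  moreover have "emeasure (uniform_measure (csbm n a b) (Collect A \<times> space ?N)) (X \<times> Y)
      = emeasure (csbm n a b) ((Collect A \<inter> X) \<times> Y) / emeasure (csbm n a b) (Collect A \<times> space ?N)"
    unfolding int[symmetric] using Y
    by (intro emeasure_uniform_measure) (auto simp: csbm_def)
  ultimately show "emeasure (measure_pmf (cond_pmf graph_pmf (Collect A))) X * emeasure ?N Y
      = emeasure (uniform_measure (csbm n a b) {\<omega> \<in> space (csbm n a b). A (fst \<omega>)}) (X \<times> Y)"
    unfolding ev by (simp add: G Y N.emeasure_space_1 ennreal_times_divide mult.commute)
qed

text \<open>Every function of the graph is measurable, since all sets are measurable for a
  pmf.\<close>

lemma borel_measurable_fst_pmf [measurable (raw)]:
  "(\<lambda>\<omega>. f (fst \<omega>)) \<in> measurable (measure_pmf p \<Otimes>\<^sub>M N) borel"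
  by (rule measurable_compose[OF measurable_fst]) simp

text \<open>Attention computed from the noise alone; the parameter \<open>\<theta>\<close> stands for \<open>\<sigma> / T\<close>.\<close>

definition noise_attention ::
  "nat \<Rightarrow> real^('d::finite) \<Rightarrow> real \<Rightarrow> (nat \<Rightarrow> real^'d) \<Rightarrow> nat set \<Rightarrow> nat \<Rightarrow> real" where
  "noise_attention i w \<theta> x S j = softmax S (\<lambda>r. - (\<theta> * wl1 w (x i) (x r))) j"

definition noise_score ::
  "nat \<Rightarrow> nat \<Rightarrow> real^('d::finite) \<Rightarrow> real \<Rightarrow> 'd outcome \<Rightarrow> real" where
  "noise_score n i w \<theta> \<omega> =
     (\<Sum>j\<in>nbhd n i \<omega>. noise_attention i w \<theta> (snd \<omega>) (nbhd n i \<omega>) j * label \<omega> j)"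

lemma attention_eq_softmax:
  "attention n i \<mu> w \<sigma> T \<omega> j = softmax (nbhd n i \<omega>) (\<lambda>r. logit \<mu> w \<sigma> i \<omega> r / T) j"
  by (simp add: attention_def softmax_def)

lemma finite_nbhd [simp]: "finite (nbhd n i \<omega>)"
  by (simp add: nbhd_eq_graph_nbhd)

lemma nbhd_less: "j \<in> nbhd n i \<omega> \<Longrightarrow> j < n"
  by (simp add: nbhd_def)

lemma logit_eq_wl1: "logit \<mu> w \<sigma> i \<omega> j = - wl1 w (feature \<mu> \<sigma> \<omega> i) (feature \<mu> \<sigma> \<omega> j)"
  by (simp add: logit_def wl1_def)

lemma wl1_diff_le:
  assumes w: "\<forall>l. 0 < w $ l"
  shows "\<bar>wl1 w u v - wl1 w u' v'\<bar> \<le> wl1 w (u - u') (v - v')"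
proof -
  have "\<bar>wl1 w u v - wl1 w u' v'\<bar>
      = \<bar>\<Sum>l\<in>UNIV. w $ l * (\<bar>u $ l - v $ l\<bar> - \<bar>u' $ l - v' $ l\<bar>)\<bar>"
    unfolding wl1_def by (simp add: sum_subtractf right_diff_distrib)
  also have "\<dots> \<le> (\<Sum>l\<in>UNIV. w $ l * \<bar>(u - u') $ l - (v - v') $ l\<bar>)"
  proof (intro order_trans[OF sum_abs] sum_mono)
    fix l
    have "\<bar>\<bar>u $ l - v $ l\<bar> - \<bar>u' $ l - v' $ l\<bar>\<bar> \<le> \<bar>(u - u') $ l - (v - v') $ l\<bar>" by simp
    then show "\<bar>w $ l * (\<bar>u $ l - v $ l\<bar> - \<bar>u' $ l - v' $ l\<bar>)\<bar> \<le> w $ l * \<bar>(u - u') $ l - (v - v') $ l\<bar>"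
      using w by (simp add: abs_mult mult_left_mono less_imp_le)
  qed
  finally show ?thesis unfolding wl1_def .
qed

lemma wl1_scaleR: "wl1 w (s *\<^sub>R u) (s *\<^sub>R v) = \<bar>s\<bar> * wl1 w u v"
  unfolding wl1_def by (simp add: sum_distrib_left abs_mult mult_ac flip: right_diff_distrib)

lemma wl1_nonneg:
  assumes "\<forall>l. 0 < w $ l"
  shows "0 \<le> wl1 w u v"
  unfolding wl1_def using assms by (intro sum_nonneg) (simp add: less_imp_le)

text \<open>The common bound also makes the real-valued supremum bounded above; the empty set then
  shows that it is nonnegative.\<close>

lemma tv_dist_bounds:
  assumes "\<And>B. B \<in> sets P \<Longrightarrow> \<bar>measure P B - measure Q B\<bar> \<le> r"
  shows "0 \<le> tv_dist P Q" "tv_dist P Q \<le> r"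
proof -
  have "bdd_above ((\<lambda>B. \<bar>measure P B - measure Q B\<bar>) ` sets P)"
    using assms by (intro bdd_aboveI2)
  then have "\<bar>measure P {} - measure Q {}\<bar> \<le> tv_dist P Q"
    unfolding tv_dist_def by (intro cSUP_upper) auto
  then show "0 \<le> tv_dist P Q" by simp
  show "tv_dist P Q \<le> r"
    unfolding tv_dist_def using assms by (intro cSUP_least) auto
qed

lemma sets_logit_law: "sets (logit_law n a b i \<mu> w \<sigma> S A) = sets (\<Pi>\<^sub>M j\<in>S. borel)"
  by (simp add: logit_law_def)

locale attention_target = csbm_target n i a b for n i a b +
  fixes Ks :: "nat set" and \<mu> w :: "real^('d::finite)"
  assumes Ks_ne: "Ks \<noteq> {}" and Ks_sub: "Ks \<subseteq> {1<..<n}" and w_pos: "\<forall>l. 0 < w $ l"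
begin

abbreviation "target_event c \<equiv> {g. fst g i = c \<and> card (graph_nbhd n i g) \<in> Ks}"
abbreviation "target_graph c \<equiv> cond_pmf graph_pmf (target_event c)"
abbreviation "target c \<equiv> target_model n a b i Ks c :: 'd outcome measure"

lemma target_event_possible:
  assumes "c \<in> {-1, 1}"
  shows "set_pmf graph_pmf \<inter> target_event c \<noteq> {}"
proof -
  obtain k where k: "k \<in> Ks" using Ks_ne by blast
  then have "k < n" using Ks_sub by force
  then have "k \<le> card ({..<n} - {i})" using i_less_n by simp
  then obtain S where S: "S \<subseteq> {..<n} - {i}" "card S = k"
    by (meson obtain_subset_with_card_n)
  show ?thesis
    using nbhd_labels_possible[OF S(1) assms, of "\<lambda>_. 1"] S(2) k by auto
qed

lemma target_eq:
  assumes "c \<in> {-1, 1}"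
  shows "target c = measure_pmf (target_graph c) \<Otimes>\<^sub>M noise_space {..<n}"
  using uniform_measure_csbm[of "\<lambda>g. fst g i = c \<and> card (graph_nbhd n i g) \<in> Ks"]
    target_event_possible[OF assms]
  by (simp add: target_model_def label_def nbhd_eq_graph_nbhd)

lemma sum_over_nbhds:
  "of_bool (g \<in> target_event c) * F (graph_nbhd n i g) g
    = (\<Sum>S | S \<subseteq> {..<n} - {i} \<and> card S \<in> Ks. of_bool (fst g i = c \<and> graph_nbhd n i g = S) * F S g)"
  (is "_ = (\<Sum>S\<in>?A. _)") for F :: "nat set \<Rightarrow> _ \<Rightarrow> real"
proof (cases "g \<in> target_event c")
  case True
  have "finite ?A" by (rule finite_subset[of _ "Pow {..<n}"]) auto
  moreover have "graph_nbhd n i g \<in> ?A" using True graph_nbhd_subset by auto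
  ultimately have "(\<Sum>S\<in>?A. of_bool (fst g i = c \<and> graph_nbhd n i g = S) * F S g)
      = (\<Sum>S\<in>{graph_nbhd n i g}. of_bool (fst g i = c \<and> graph_nbhd n i g = S) * F S g)"
    by (intro sum.mono_neutral_right) auto
  then show ?thesis using True by simp
next
  case False
  then have "(\<Sum>S\<in>?A. of_bool (fst g i = c \<and> graph_nbhd n i g = S) * F S g) = 0"
    by (intro sum.neutral) auto
  then show ?thesis using False by simp
qed

text \<open>Reduces conditioning on the number of neighbours to a sum over exact neighbourhoods;
  both sides carry the same normalizing probability.\<close>

lemma expectation_target_graph:
  fixes F F' :: "nat set \<Rightarrow> (nat \<Rightarrow> real) \<times> nat set set \<Rightarrow> real"
  assumes c: "c \<in> {-1, 1}"
    and FF': "\<And>S. S \<subseteq> {..<n} - {i} \<Longrightarrow>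
      measure_pmf.expectation graph_pmf (\<lambda>g. of_bool (fst g i = c \<and> graph_nbhd n i g = S) * F S g)
      = K * measure_pmf.expectation graph_pmf (\<lambda>g. of_bool (fst g i = c \<and> graph_nbhd n i g = S) * F' S g)"
  shows "measure_pmf.expectation (target_graph c) (\<lambda>g. F (graph_nbhd n i g) g)
    = K * measure_pmf.expectation (target_graph c) (\<lambda>g. F' (graph_nbhd n i g) g)"
proof -
  have "measure_pmf.expectation graph_pmf (\<lambda>g. of_bool (g \<in> target_event c) * F (graph_nbhd n i g) g)
      = (\<Sum>S | S \<subseteq> {..<n} - {i} \<and> card S \<in> Ks. measure_pmf.expectation graph_pmf
          (\<lambda>g. of_bool (fst g i = c \<and> graph_nbhd n i g = S) * F S g))" for F :: "nat set \<Rightarrow> _ \<Rightarrow> real"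
    unfolding sum_over_nbhds by (rule Bochner_Integration.integral_sum[OF integrable_graph_pmf])
  note E = this
  have "measure_pmf.expectation graph_pmf (\<lambda>g. of_bool (g \<in> target_event c) * F (graph_nbhd n i g) g)
    = K * measure_pmf.expectation graph_pmf (\<lambda>g. of_bool (g \<in> target_event c) * F' (graph_nbhd n i g) g)"
    unfolding E[of F] E[of F'] sum_distrib_left by (intro sum.cong refl FF') auto
  then show ?thesis
    using expectation_cond_pmf[OF finite_set_graph_pmf target_event_possible[OF c]] by simp
qed

text \<open>The weights \<beta> may depend on the neighbourhood but not on the labels. This is where
  independence enters: the lemma is applied with the noise held fixed.\<close>

lemma expectation_weighted_labels:
  assumes c: "c \<in> {-1, 1}"
  shows "measure_pmf.expectation (target_graph c) (\<lambda>g. \<Sum>j\<in>graph_nbhd n i g. \<beta> (graph_nbhd n i g) j * fst g j)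
    = m * c * measure_pmf.expectation (target_graph c) (\<lambda>g. \<Sum>j\<in>graph_nbhd n i g. \<beta> (graph_nbhd n i g) j)"
proof (rule expectation_target_graph[OF c, where F = "\<lambda>S g. \<Sum>j\<in>S. \<beta> S j * fst g j"
      and F' = "\<lambda>S g. \<Sum>j\<in>S. \<beta> S j"])
  fix S assume S: "S \<subseteq> {..<n} - {i}"
  have "measure_pmf.expectation graph_pmf
      (\<lambda>g. of_bool (fst g i = c \<and> graph_nbhd n i g = S) * (\<Sum>j\<in>S. \<beta> S j * fst g j))
    = measure_pmf.expectation graph_pmf
      (\<lambda>g. \<Sum>j\<in>S. \<beta> S j * (of_bool (fst g i = c \<and> graph_nbhd n i g = S) * fst g j))"
    by (intro Bochner_Integration.integral_cong refl) (simp add: of_bool_def)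
  also have "\<dots> = (\<Sum>j\<in>S. \<beta> S j * (m * c * nbhd_weight S c))"
    by (subst Bochner_Integration.integral_sum) (auto simp: integrable_graph_pmf expectation_label[OF S c] intro!: sum.cong)
  also have "\<dots> = m * c * (nbhd_weight S c * (\<Sum>j\<in>S. \<beta> S j))"
    by (simp add: sum_distrib_left sum_distrib_right mult_ac)
  finally show "measure_pmf.expectation graph_pmf
      (\<lambda>g. of_bool (fst g i = c \<and> graph_nbhd n i g = S) * (\<Sum>j\<in>S. \<beta> S j * fst g j))
    = m * c * measure_pmf.expectation graph_pmf
      (\<lambda>g. of_bool (fst g i = c \<and> graph_nbhd n i g = S) * (\<Sum>j\<in>S. \<beta> S j))"
    by simp
qed

lemma expectation_weighted_labels_square:
  assumes c: "c \<in> {-1, 1}"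
  shows "measure_pmf.expectation (target_graph c) (\<lambda>g. (\<Sum>j\<in>graph_nbhd n i g. \<beta> (graph_nbhd n i g) j * fst g j)\<^sup>2)
    = measure_pmf.expectation (target_graph c) (\<lambda>g. m\<^sup>2 * (\<Sum>j\<in>graph_nbhd n i g. \<beta> (graph_nbhd n i g) j)\<^sup>2
        + (1 - m\<^sup>2) * (\<Sum>j\<in>graph_nbhd n i g. (\<beta> (graph_nbhd n i g) j)\<^sup>2))"
proof -
  have "measure_pmf.expectation (target_graph c) (\<lambda>g. (\<Sum>j\<in>graph_nbhd n i g. \<beta> (graph_nbhd n i g) j * fst g j)\<^sup>2)
    = 1 * measure_pmf.expectation (target_graph c) (\<lambda>g. m\<^sup>2 * (\<Sum>j\<in>graph_nbhd n i g. \<beta> (graph_nbhd n i g) j)\<^sup>2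
        + (1 - m\<^sup>2) * (\<Sum>j\<in>graph_nbhd n i g. (\<beta> (graph_nbhd n i g) j)\<^sup>2))"
  proof (rule expectation_target_graph[OF c, where F = "\<lambda>S g. (\<Sum>j\<in>S. \<beta> S j * fst g j)\<^sup>2"
        and F' = "\<lambda>S g. m\<^sup>2 * (\<Sum>j\<in>S. \<beta> S j)\<^sup>2 + (1 - m\<^sup>2) * (\<Sum>j\<in>S. (\<beta> S j)\<^sup>2)"])
    fix S assume S: "S \<subseteq> {..<n} - {i}"
    then have fin: "finite S" by (rule finite_subset) simp
    have "measure_pmf.expectation graph_pmf
        (\<lambda>g. of_bool (fst g i = c \<and> graph_nbhd n i g = S) * (\<Sum>j\<in>S. \<beta> S j * fst g j)\<^sup>2)
      = measure_pmf.expectation graph_pmf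
        (\<lambda>g. \<Sum>j\<in>S. \<Sum>k\<in>S. \<beta> S j * \<beta> S k * (of_bool (fst g i = c \<and> graph_nbhd n i g = S) * (fst g j * fst g k)))"
      by (intro Bochner_Integration.integral_cong refl)
         (simp add: of_bool_def power2_eq_square sum_product mult_ac)
    also have "\<dots> = (\<Sum>j\<in>S. \<Sum>k\<in>S. \<beta> S j * \<beta> S k * ((if j = k then 1 else m\<^sup>2) * nbhd_weight S c))"
      by (auto simp: integrable_graph_pmf expectation_label_mult[OF S c] Bochner_Integration.integral_sum
          intro!: sum.cong)
    \<comment> \<open>The matrix of second moments of the labels is \<open>m\<^sup>2\<close>
      everywhere plus \<open>1 - m\<^sup>2\<close> on the diagonal.\<close>
    also have "\<dots> = (\<Sum>j\<in>S. \<Sum>k\<in>S. nbhd_weight S c * (m\<^sup>2 * (\<beta> S j * \<beta> S k)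
        + (if j = k then (1 - m\<^sup>2) * (\<beta> S j)\<^sup>2 else 0)))"
      by (intro sum.cong refl) (auto simp: algebra_simps power2_eq_square)
    also have "\<dots> = nbhd_weight S c * (m\<^sup>2 * (\<Sum>j\<in>S. \<beta> S j)\<^sup>2 + (1 - m\<^sup>2) * (\<Sum>j\<in>S. (\<beta> S j)\<^sup>2))"
      using fin by (simp add: sum.distrib sum_product power2_eq_square flip: sum_distrib_left)
    finally show "measure_pmf.expectation graph_pmf
        (\<lambda>g. of_bool (fst g i = c \<and> graph_nbhd n i g = S) * (\<Sum>j\<in>S. \<beta> S j * fst g j)\<^sup>2)
      = 1 * measure_pmf.expectation graph_pmf
        (\<lambda>g. of_bool (fst g i = c \<and> graph_nbhd n i g = S)
           * (m\<^sup>2 * (\<Sum>j\<in>S. \<beta> S j)\<^sup>2 + (1 - m\<^sup>2) * (\<Sum>j\<in>S. (\<beta> S j)\<^sup>2)))"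
      by simp
  qed
  then show ?thesis by simp
qed

section \<open>Measurability of logits and attention\<close>

lemma logit_measurable:
  assumes j: "j < n"
  shows "(\<lambda>\<omega>. logit \<mu> w \<sigma> i \<omega> j) \<in> borel_measurable (measure_pmf p \<Otimes>\<^sub>M noise_space {..<n})"
proof -
  have [measurable]: "(\<lambda>\<omega>. snd \<omega> k) \<in> borel_measurable (measure_pmf p \<Otimes>\<^sub>M noise_space {..<n} :: 'd outcome measure)"
    if "k < n" for k
    using that by (intro measurable_compose[OF measurable_snd noise_component_measurable]) auto
  show ?thesis
    unfolding logit_eq_wl1 feature_def label_def noise_def
    using j i_less_n by measurable
qed

text \<open>A sum over a random index set becomes a sum over all nodes with random 0-1
  coefficients.\<close>

lemma sum_nbhd_measurable:
  fixes F :: "'d outcome \<Rightarrow> nat \<Rightarrow> real"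
  assumes F [measurable]: "\<And>j. j < n \<Longrightarrow> (\<lambda>\<omega>. F \<omega> j) \<in> borel_measurable (measure_pmf p \<Otimes>\<^sub>M N)"
  shows "(\<lambda>\<omega>. \<Sum>j\<in>nbhd n i \<omega>. F \<omega> j) \<in> borel_measurable (measure_pmf p \<Otimes>\<^sub>M N)"
proof -
  have "(\<Sum>j\<in>nbhd n i \<omega>. F \<omega> j) = (\<Sum>j<n. of_bool (j \<in> graph_nbhd n i (fst \<omega>)) * F \<omega> j)" for \<omega>
  proof -
    have "(\<Sum>j\<in>nbhd n i \<omega>. F \<omega> j) = (\<Sum>j\<in>nbhd n i \<omega>. of_bool (j \<in> graph_nbhd n i (fst \<omega>)) * F \<omega> j)"
      by (intro sum.cong) (auto simp: nbhd_eq_graph_nbhd)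
    also have "\<dots> = (\<Sum>j<n. of_bool (j \<in> graph_nbhd n i (fst \<omega>)) * F \<omega> j)"
      by (intro sum.mono_neutral_left) (auto simp: nbhd_eq_graph_nbhd graph_nbhd_def)
    finally show ?thesis .
  qed
  moreover have "(\<lambda>\<omega>. \<Sum>j<n. of_bool (j \<in> graph_nbhd n i (fst \<omega>)) * F \<omega> j) \<in> borel_measurable (measure_pmf p \<Otimes>\<^sub>M N)"
    by (intro borel_measurable_sum borel_measurable_times F
          borel_measurable_fst_pmf[where f = "\<lambda>g. of_bool (_ \<in> graph_nbhd n i g)"]) auto
  ultimately show ?thesis by simp
qed

lemma softmax_nbhd_measurable:
  assumes e: "\<And>j. j < n \<Longrightarrow> (\<lambda>\<omega>. e \<omega> j) \<in> borel_measurable (measure_pmf p \<Otimes>\<^sub>M N)" and j: "j < n"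
  shows "(\<lambda>\<omega> :: 'd outcome. softmax (nbhd n i \<omega>) (e \<omega>) j) \<in> borel_measurable (measure_pmf p \<Otimes>\<^sub>M N)"
  unfolding softmax_def
  by (intro borel_measurable_divide sum_nbhd_measurable measurable_compose[OF e borel_measurable_exp] j)

lemma attention_measurable:
  "j < n \<Longrightarrow> (\<lambda>\<omega>. attention n i \<mu> w \<sigma> T \<omega> j) \<in> borel_measurable (measure_pmf p \<Otimes>\<^sub>M noise_space {..<n})"
  by (auto simp: attention_eq_softmax intro!: softmax_nbhd_measurable borel_measurable_divide logit_measurable)

section \<open>Outcomes in the high-noise limit\<close>

abbreviation "noise_dist \<omega> j \<equiv> wl1 w (snd \<omega> i) (snd \<omega> j)" for \<omega> :: "'d outcome"

text \<open>Injectivity of the noise distances makes the nearest neighbour unique.\<close>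

definition regular :: "'d outcome \<Rightarrow> bool" where
  "regular \<omega> \<longleftrightarrow> (\<forall>j<n. label \<omega> j \<in> {-1, 1}) \<and> card (nbhd n i \<omega>) \<in> Ks
     \<and> inj_on (noise_dist \<omega>) ({..<n} - {i})"

lemma pair_prob_space_target:
  "pair_prob_space (measure_pmf (target_graph c)) (noise_space {..<n} :: (nat \<Rightarrow> real^'d) measure)"
  unfolding pair_prob_space_def pair_sigma_finite_def
  using measure_pmf.prob_space_axioms prob_space_noise
  by (auto intro: prob_space_imp_sigma_finite)

lemma prob_space_target:
  assumes "c \<in> {-1, 1}"
  shows "prob_space (target c)"
proof -
  interpret Q: pair_prob_space "measure_pmf (target_graph c)" "noise_space {..<n} :: (nat \<Rightarrow> real^'d) measure"
    by (rule pair_prob_space_target)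
  show ?thesis unfolding target_eq[OF assms] by (rule Q.prob_space_axioms)
qed

lemma snd_measurable:
  "k < n \<Longrightarrow> (\<lambda>\<omega>. snd \<omega> k) \<in> borel_measurable (measure_pmf p \<Otimes>\<^sub>M noise_space {..<n})"
  by (intro measurable_compose[OF measurable_snd noise_component_measurable]) auto

lemma AE_regular:
  assumes c: "c \<in> {-1, 1}"
  shows "AE \<omega> in target c. regular \<omega>"
proof -
  let ?N = "noise_space {..<n} :: (nat \<Rightarrow> real^'d) measure"
  let ?P = "measure_pmf (target_graph c) \<Otimes>\<^sub>M ?N"
  interpret P: pair_prob_space "measure_pmf (target_graph c)" ?N
    by (rule pair_prob_space_target)
  have 1: "AE \<omega> in ?P. (\<forall>j<n. label \<omega> j \<in> {-1, 1}) \<and> card (nbhd n i \<omega>) \<in> Ks"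
  proof (rule P.AE_pair_measure)
    let ?Q = "\<lambda>g. (\<forall>j<n. fst g j \<in> {-1, 1}) \<and> card (graph_nbhd n i g) \<in> Ks"
    have "{\<omega> \<in> space ?P. (\<forall>j<n. label \<omega> j \<in> {-1, 1}) \<and> card (nbhd n i \<omega>) \<in> Ks} = Collect ?Q \<times> space ?N"
      by (auto simp: label_def nbhd_eq_graph_nbhd space_pair_measure)
    then show "{\<omega> \<in> space ?P. (\<forall>j<n. label \<omega> j \<in> {-1, 1}) \<and> card (nbhd n i \<omega>) \<in> Ks} \<in> sets ?P"
      by simp
    show "AE g in measure_pmf (target_graph c). AE x in ?N.
        (\<forall>j<n. label (g, x) j \<in> {-1, 1}) \<and> card (nbhd n i (g, x)) \<in> Ks"
      using label_cases set_cond_pmf[OF target_event_possible[OF c]]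
      by (intro AE_pmfI) (auto simp: label_def nbhd_eq_graph_nbhd)
  qed
  have 2: "AE \<omega> in ?P. noise_dist \<omega> j \<noteq> noise_dist \<omega> k"
    if jk: "j \<in> {..<n} - {i}" "k \<in> {..<n} - {i}" "j \<noteq> k" for j k
  proof (rule P.AE_pair_measure)
    have [measurable]: "(\<lambda>\<omega>. noise_dist \<omega> j) \<in> borel_measurable ?P"
      "(\<lambda>\<omega>. noise_dist \<omega> k) \<in> borel_measurable ?P"
      using jk i_less_n by (auto intro!: wl1_measurable snd_measurable)
    show "{\<omega> \<in> space ?P. noise_dist \<omega> j \<noteq> noise_dist \<omega> k} \<in> sets ?P"
      by measurable
    show "AE g in measure_pmf (target_graph c). AE x in ?N. noise_dist (g, x) j \<noteq> noise_dist (g, x) k"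
      using AE_noise_wl1_neq[OF w_pos, of "{..<n}" i j k] jk i_less_n by auto
  qed
  have "AE \<omega> in ?P. \<forall>j\<in>{..<n} - {i}. \<forall>k\<in>{..<n} - {i}. j \<noteq> k \<longrightarrow> noise_dist \<omega> j \<noteq> noise_dist \<omega> k"
  proof (intro AE_finite_allI)
    fix j k assume "j \<in> {..<n} - {i}" "k \<in> {..<n} - {i}"
    then show "AE \<omega> in ?P. j \<noteq> k \<longrightarrow> noise_dist \<omega> j \<noteq> noise_dist \<omega> k"
      using 2[of j k] by (cases "j = k") auto
  qed auto
  with 1 show ?thesis
    unfolding target_eq[OF c] by eventually_elim (auto simp: regular_def inj_on_def)
qed

lemma regular_card: "regular \<omega> \<Longrightarrow> 2 \<le> card (nbhd n i \<omega>)"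
  using Ks_sub by (auto simp: regular_def)

lemma regular_nonempty: "regular \<omega> \<Longrightarrow> nbhd n i \<omega> \<noteq> {}"
  using regular_card by fastforce

lemma regular_label: "regular \<omega> \<Longrightarrow> j < n \<Longrightarrow> label \<omega> j \<in> {-1, 1}"
  by (simp add: regular_def)

lemma regular_abs_label: "regular \<omega> \<Longrightarrow> j \<in> nbhd n i \<omega> \<Longrightarrow> \<bar>label \<omega> j\<bar> \<le> 1"
  using regular_label[of \<omega> j] nbhd_less[of j n i \<omega>] by auto

text \<open>Labels differ by at most 2, so the signal parts of two features differ by at most
  \<open>2 *\<^sub>R \<mu>\<close> up to sign; this is the weighted l1 norm of that vector.\<close>

definition label_effect :: real where
  "label_effect = 2 * wl1 w \<mu> 0"

lemma label_effect_nonneg: "0 \<le> label_effect"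
  unfolding label_effect_def using wl1_nonneg[OF w_pos] by simp

text \<open>By the reverse triangle inequality, deleting the signal from both features changes their
  distance by at most the size of the signal difference, whatever \<sigma> is.\<close>

lemma logit_noise_dist:
  assumes reg: "regular \<omega>" and j: "j < n" and \<sigma>: "0 \<le> \<sigma>"
  shows "\<bar>logit \<mu> w \<sigma> i \<omega> j + \<sigma> * noise_dist \<omega> j\<bar> \<le> label_effect"
proof -
  have "\<bar>logit \<mu> w \<sigma> i \<omega> j + \<sigma> * noise_dist \<omega> j\<bar>
      = \<bar>wl1 w (feature \<mu> \<sigma> \<omega> i) (feature \<mu> \<sigma> \<omega> j) - wl1 w (\<sigma> *\<^sub>R snd \<omega> i) (\<sigma> *\<^sub>R snd \<omega> j)\<bar>"
    using \<sigma> by (simp add: logit_eq_wl1 wl1_scaleR abs_minus_commute)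
  also have "\<dots> \<le> wl1 w (label \<omega> i *\<^sub>R \<mu>) (label \<omega> j *\<^sub>R \<mu>)"
    using wl1_diff_le[OF w_pos, of "feature \<mu> \<sigma> \<omega> i" "feature \<mu> \<sigma> \<omega> j" "\<sigma> *\<^sub>R snd \<omega> i" "\<sigma> *\<^sub>R snd \<omega> j"]
    by (simp add: feature_def noise_def)
  also have "\<dots> = (\<Sum>l\<in>UNIV. w $ l * (\<bar>label \<omega> i - label \<omega> j\<bar> * \<bar>\<mu> $ l\<bar>))"
    unfolding wl1_def by (simp flip: left_diff_distrib abs_mult)
  also have "\<dots> \<le> (\<Sum>l\<in>UNIV. w $ l * (2 * \<bar>\<mu> $ l\<bar>))"
    using regular_label[OF reg j] regular_label[OF reg i_less_n] w_pos
    by (intro sum_mono mult_left_mono mult_right_mono) (auto simp: less_imp_le)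
  also have "\<dots> = label_effect"
    unfolding label_effect_def wl1_def by (simp add: sum_distrib_left mult_ac)
  finally show ?thesis .
qed

lemma attention_close:
  assumes reg: "regular \<omega>" and j: "j \<in> nbhd n i \<omega>" and \<sigma>: "0 \<le> \<sigma>" and T: "0 < T"
  shows "\<bar>attention n i \<mu> w \<sigma> T \<omega> j - noise_attention i w (\<sigma> / T) (snd \<omega>) (nbhd n i \<omega>) j\<bar>
    \<le> exp (2 * (label_effect / T)) - 1"
  unfolding attention_eq_softmax noise_attention_def
proof (rule softmax_perturb)
  fix r assume "r \<in> nbhd n i \<omega>"
  then have "\<bar>logit \<mu> w \<sigma> i \<omega> r + \<sigma> * noise_dist \<omega> r\<bar> \<le> label_effect"
    using logit_noise_dist[OF reg _ \<sigma>] nbhd_less by blast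
  moreover have "logit \<mu> w \<sigma> i \<omega> r / T - - (\<sigma> / T * noise_dist \<omega> r)
      = (logit \<mu> w \<sigma> i \<omega> r + \<sigma> * noise_dist \<omega> r) / T"
    by (simp add: add_divide_distrib)
  ultimately show "\<bar>logit \<mu> w \<sigma> i \<omega> r / T - - (\<sigma> / T * noise_dist \<omega> r)\<bar> \<le> label_effect / T"
    using T by (simp add: divide_right_mono abs_divide)
qed (use j in simp_all)

text \<open>The Herfindahl index of the attention weights: 1/K for uniform weights, 1 for weights on
  a single neighbour.\<close>

definition sq_weights :: "real \<Rightarrow> real \<Rightarrow> 'd outcome \<Rightarrow> real" where
  "sq_weights \<sigma> T \<omega> = (\<Sum>j\<in>nbhd n i \<omega>. (attention n i \<mu> w \<sigma> T \<omega> j)\<^sup>2)"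

definition noise_sq_weights :: "real \<Rightarrow> 'd outcome \<Rightarrow> real" where
  "noise_sq_weights \<theta> \<omega> = (\<Sum>j\<in>nbhd n i \<omega>. (noise_attention i w \<theta> (snd \<omega>) (nbhd n i \<omega>) j)\<^sup>2)"

abbreviation "scr \<sigma> T \<equiv> score n i \<mu> w \<sigma> T"
abbreviation "nscr \<theta> \<equiv> noise_score n i w \<theta>"

lemma attention_simplex:
  assumes reg: "regular \<omega>"
  shows "0 \<le> attention n i \<mu> w \<sigma> T \<omega> j" "j \<in> nbhd n i \<omega> \<Longrightarrow> attention n i \<mu> w \<sigma> T \<omega> j \<le> 1"
    "(\<Sum>j\<in>nbhd n i \<omega>. attention n i \<mu> w \<sigma> T \<omega> j) = 1"
  using regular_nonempty[OF reg]
  by (auto simp: attention_eq_softmax softmax_nonneg sum_softmax softmax_le_1)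

lemma noise_attention_simplex:
  assumes reg: "regular \<omega>"
  shows "0 \<le> noise_attention i w \<theta> x S j"
    "j \<in> nbhd n i \<omega> \<Longrightarrow> noise_attention i w \<theta> x (nbhd n i \<omega>) j \<le> 1"
    "(\<Sum>j\<in>nbhd n i \<omega>. noise_attention i w \<theta> x (nbhd n i \<omega>) j) = 1"
  using regular_nonempty[OF reg]
  by (auto simp: noise_attention_def softmax_nonneg sum_softmax softmax_le_1)

lemma abs_score_le: "regular \<omega> \<Longrightarrow> \<bar>scr \<sigma> T \<omega>\<bar> \<le> 1"
  unfolding score_def by (intro abs_weighted_sum_le_1 attention_simplex regular_abs_label)

lemma abs_noise_score_le: "regular \<omega> \<Longrightarrow> \<bar>nscr \<theta> \<omega>\<bar> \<le> 1"
  unfolding noise_score_def by (intro abs_weighted_sum_le_1 noise_attention_simplex regular_abs_label)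

lemma abs_sq_weights_le:
  assumes "regular \<omega>"
  shows "\<bar>sq_weights \<sigma> T \<omega>\<bar> \<le> 1"
proof -
  have "\<bar>\<Sum>j\<in>nbhd n i \<omega>. attention n i \<mu> w \<sigma> T \<omega> j * attention n i \<mu> w \<sigma> T \<omega> j\<bar> \<le> 1"
    using attention_simplex[OF assms] by (intro abs_weighted_sum_le_1) auto
  then show ?thesis by (simp add: sq_weights_def power2_eq_square)
qed

lemma abs_noise_sq_weights_le:
  assumes "regular \<omega>"
  shows "\<bar>noise_sq_weights \<theta> \<omega>\<bar> \<le> 1"
proof -
  have "\<bar>\<Sum>j\<in>nbhd n i \<omega>. noise_attention i w \<theta> (snd \<omega>) (nbhd n i \<omega>) j
      * noise_attention i w \<theta> (snd \<omega>) (nbhd n i \<omega>) j\<bar> \<le> 1"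
    using noise_attention_simplex[OF assms] by (intro abs_weighted_sum_le_1) auto
  then show ?thesis by (simp add: noise_sq_weights_def power2_eq_square)
qed

text \<open>Bounds the effect of the labels on the score, uniformly in \<open>\<sigma>\<close> and in the outcome.\<close>

definition perturbation :: "real \<Rightarrow> real" where
  "perturbation T = n * (exp (2 * (label_effect / T)) - 1)"

text \<open>Lets the error at temperature \<sigma> serve all T \<ge> \<sigma> at once.\<close>

lemma perturbation_antimono: "0 < s \<Longrightarrow> s \<le> T \<Longrightarrow> perturbation T \<le> perturbation s"
  unfolding perturbation_def
  by (intro mult_left_mono diff_right_mono) (simp_all add: label_effect_nonneg divide_left_mono)

lemma perturbation_tendsto_0: "(perturbation \<longlongrightarrow> 0) at_top"
proof -
  have "((\<lambda>T. n * (exp (2 * (label_effect / T)) - 1)) \<longlongrightarrow> n * (exp (2 * 0) - 1)) at_top"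
    by (intro tendsto_intros tendsto_divide_0[OF tendsto_const] filterlim_at_top_imp_at_infinity filterlim_ident)
  then show ?thesis by (simp add: perturbation_def[abs_def])
qed

lemma sum_nbhd_le_perturbation:
  assumes "\<And>j. j \<in> nbhd n i \<omega> \<Longrightarrow> \<bar>f j\<bar> \<le> exp (2 * (label_effect / T)) - 1" and T: "0 < T"
  shows "\<bar>\<Sum>j\<in>nbhd n i \<omega>. f j\<bar> \<le> perturbation T"
proof -
  have "\<bar>\<Sum>j\<in>nbhd n i \<omega>. f j\<bar> \<le> (\<Sum>j\<in>nbhd n i \<omega>. exp (2 * (label_effect / T)) - 1)"
    using assms(1) by (intro order_trans[OF sum_abs] sum_mono)
  also have "\<dots> = card (nbhd n i \<omega>) * (exp (2 * (label_effect / T)) - 1)"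
    by simp
  also have "\<dots> \<le> n * (exp (2 * (label_effect / T)) - 1)"
  proof (rule mult_right_mono)
    have "card (nbhd n i \<omega>) \<le> card {..<n}"
      by (intro card_mono) (auto dest: nbhd_less)
    then show "real (card (nbhd n i \<omega>)) \<le> real n" by simp
    show "0 \<le> exp (2 * (label_effect / T)) - 1"
      using T label_effect_nonneg by simp
  qed
  finally show ?thesis by (simp add: perturbation_def)
qed

lemma score_close:
  assumes reg: "regular \<omega>" and \<sigma>: "0 \<le> \<sigma>" and T: "0 < T"
  shows "\<bar>scr \<sigma> T \<omega> - nscr (\<sigma> / T) \<omega>\<bar> \<le> perturbation T"
proof -
  have "scr \<sigma> T \<omega> - nscr (\<sigma> / T) \<omega> = (\<Sum>j\<in>nbhd n i \<omega>. (attention n i \<mu> w \<sigma> T \<omega> j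
      - noise_attention i w (\<sigma> / T) (snd \<omega>) (nbhd n i \<omega>) j) * label \<omega> j)"
    by (simp add: score_def noise_score_def sum_subtractf left_diff_distrib)
  also have "\<bar>\<dots>\<bar> \<le> perturbation T"
  proof (intro sum_nbhd_le_perturbation T)
    fix j assume j: "j \<in> nbhd n i \<omega>"
    have "\<bar>label \<omega> j\<bar> = 1" using regular_label[OF reg nbhd_less[OF j]] by auto
    then show "\<bar>(attention n i \<mu> w \<sigma> T \<omega> j - noise_attention i w (\<sigma> / T) (snd \<omega>) (nbhd n i \<omega>) j) * label \<omega> j\<bar>
        \<le> exp (2 * (label_effect / T)) - 1"
      using attention_close[OF reg j \<sigma> T] by (simp add: abs_mult)
  qed
  finally show ?thesis .
qed

lemma sq_weights_close:
  assumes reg: "regular \<omega>" and \<sigma>: "0 \<le> \<sigma>" and T: "0 < T"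
  shows "\<bar>sq_weights \<sigma> T \<omega> - noise_sq_weights (\<sigma> / T) \<omega>\<bar> \<le> 2 * perturbation T"
proof -
  let ?d = "\<lambda>j. (attention n i \<mu> w \<sigma> T \<omega> j)\<^sup>2 - (noise_attention i w (\<sigma> / T) (snd \<omega>) (nbhd n i \<omega>) j)\<^sup>2"
  have "sq_weights \<sigma> T \<omega> - noise_sq_weights (\<sigma> / T) \<omega> = 2 * (\<Sum>j\<in>nbhd n i \<omega>. ?d j / 2)"
    by (simp add: sq_weights_def noise_sq_weights_def sum_subtractf flip: sum_divide_distrib)
  moreover have "\<bar>\<Sum>j\<in>nbhd n i \<omega>. ?d j / 2\<bar> \<le> perturbation T"
  proof (intro sum_nbhd_le_perturbation T)
    fix j assume j: "j \<in> nbhd n i \<omega>"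
    have "\<bar>?d j\<bar> \<le> 2 * \<bar>attention n i \<mu> w \<sigma> T \<omega> j - noise_attention i w (\<sigma> / T) (snd \<omega>) (nbhd n i \<omega>) j\<bar>"
      using attention_simplex[OF reg] noise_attention_simplex[OF reg] j
      by (intro abs_square_diff_le) auto
    then show "\<bar>?d j / 2\<bar> \<le> exp (2 * (label_effect / T)) - 1"
      using attention_close[OF reg j \<sigma> T] by simp
  qed
  ultimately show ?thesis by (simp add: abs_mult)
qed

text \<open>Injectivity makes the minimum strict, and finiteness turns strictness into a positive
  gap. The minimum defining \<gamma> ranges over a nonempty set because there are at least two
  neighbours.\<close>

lemma nearest_neighbour:
  assumes reg: "regular \<omega>"
  obtains k \<gamma> where "k \<in> nbhd n i \<omega>" "0 < \<gamma>"
    "\<And>r. r \<in> nbhd n i \<omega> \<Longrightarrow> r \<noteq> k \<Longrightarrow> noise_dist \<omega> k + \<gamma> \<le> noise_dist \<omega> r"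
proof -
  let ?U = "nbhd n i \<omega>"
  obtain k where k: "is_arg_min (noise_dist \<omega>) (\<lambda>r. r \<in> ?U) k"
    using ex_is_arg_min_if_finite[OF finite_nbhd regular_nonempty[OF reg]] by blast
  then have kU: "k \<in> ?U" by (simp add: is_arg_min_def)
  have sub: "?U \<subseteq> {..<n} - {i}" by (auto simp: nbhd_def)
  have lt: "noise_dist \<omega> k < noise_dist \<omega> r" if "r \<in> ?U" "r \<noteq> k" for r
  proof -
    have "noise_dist \<omega> r \<noteq> noise_dist \<omega> k"
      using reg that kU sub unfolding regular_def inj_on_def by blast
    moreover have "noise_dist \<omega> k \<le> noise_dist \<omega> r"
      using k that by (auto simp: is_arg_min_linorder)
    ultimately show ?thesis by simp
  qed
  define \<gamma> where "\<gamma> = Min ((\<lambda>r. noise_dist \<omega> r - noise_dist \<omega> k) ` (?U - {k}))"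
  have ne: "?U - {k} \<noteq> {}"
  proof
    assume "?U - {k} = {}"
    then have "?U \<subseteq> {k}" by blast
    then have "card ?U \<le> 1" using card_mono[of "{k}" ?U] by simp
    then show False using regular_card[OF reg] by simp
  qed
  show ?thesis
  proof (rule that[OF kU])
    show "0 < \<gamma>" unfolding \<gamma>_def using ne lt by (subst Min_gr_iff) auto
    fix r assume "r \<in> ?U" "r \<noteq> k"
    then have "\<gamma> \<le> noise_dist \<omega> r - noise_dist \<omega> k"
      unfolding \<gamma>_def by (intro Min_le) auto
    then show "noise_dist \<omega> k + \<gamma> \<le> noise_dist \<omega> r" by simp
  qed
qed

text \<open>Here \<open>perturbation\<close> does not vanish. Instead the true and the noise weights
  both concentrate on the nearest neighbour \<open>k\<close>, so both scores converge to the label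
  of \<open>k\<close>, whose square is 1.\<close>

lemma low_temperature_limits:
  assumes reg: "regular \<omega>"
  shows "((\<lambda>\<sigma>. scr \<sigma> 1 \<omega> - nscr \<sigma> \<omega>) \<longlongrightarrow> 0) at_top"
    and "((\<lambda>\<sigma>. (scr \<sigma> 1 \<omega>)\<^sup>2) \<longlongrightarrow> 1) at_top"
    and "((\<lambda>\<sigma>. sq_weights \<sigma> 1 \<omega>) \<longlongrightarrow> 1) at_top"
proof -
  let ?U = "nbhd n i \<omega>"
  obtain k \<gamma> where k: "k \<in> ?U" and \<gamma>: "0 < \<gamma>"
    and gap: "\<And>r. r \<in> ?U \<Longrightarrow> r \<noteq> k \<Longrightarrow> noise_dist \<omega> k + \<gamma> \<le> noise_dist \<omega> r"
    using nearest_neighbour[OF reg] by blast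
  let ?A = "\<lambda>\<sigma>. attention n i \<mu> w \<sigma> 1 \<omega>" and ?N = "\<lambda>\<sigma>. noise_attention i w \<sigma> (snd \<omega>) ?U"
  \<comment> \<open>\<open>K\<close> is the loss in the gap due to the labels:
    \<open>2 * label_effect\<close> for the true logits, as two of them are compared, and 0 for the
    noise logits.\<close>
  have exp0: "((\<lambda>\<sigma>. card ?U * exp (- (\<sigma> * \<gamma> - K))) \<longlongrightarrow> 0) at_top" for K
  proof -
    have "filterlim (\<lambda>\<sigma>. \<sigma> * \<gamma> - K) at_top at_top"
      using \<gamma> by real_asymp
    then have "((\<lambda>\<sigma>. exp (- (\<sigma> * \<gamma> - K))) \<longlongrightarrow> 0) at_top"
      by (intro filterlim_compose[OF exp_at_bot] filterlim_compose[OF filterlim_uminus_at_bot_at_top])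
    then show ?thesis by (rule tendsto_mult_right_zero)
  qed
  have A: "((\<lambda>\<sigma>. 1 - ?A \<sigma> k) \<longlongrightarrow> 0) at_top"
  proof (rule tendsto_sandwich[OF _ _ tendsto_const exp0[of "2 * label_effect"]])
    show "\<forall>\<^sub>F \<sigma> in at_top. 0 \<le> 1 - ?A \<sigma> k"
      using attention_simplex(2)[OF reg k] by simp
    show "\<forall>\<^sub>F \<sigma> in at_top. 1 - ?A \<sigma> k \<le> card ?U * exp (- (\<sigma> * \<gamma> - 2 * label_effect))"
      using eventually_ge_at_top[of 0]
    proof eventually_elim
      case (elim \<sigma>)
      show ?case
        unfolding attention_eq_softmax
      proof (rule softmax_concentrates[OF finite_nbhd k])
        fix r assume r: "r \<in> ?U" "r \<noteq> k"
        have "\<bar>logit \<mu> w \<sigma> i \<omega> r + \<sigma> * noise_dist \<omega> r\<bar> \<le> label_effect"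
          "\<bar>logit \<mu> w \<sigma> i \<omega> k + \<sigma> * noise_dist \<omega> k\<bar> \<le> label_effect"
          using r k elim by (auto intro!: logit_noise_dist[OF reg] dest: nbhd_less)
        moreover have "\<sigma> * noise_dist \<omega> k + \<sigma> * \<gamma> \<le> \<sigma> * noise_dist \<omega> r"
          using mult_left_mono[OF gap[OF r] elim] by (simp add: distrib_left)
        ultimately show "logit \<mu> w \<sigma> i \<omega> r / 1 + (\<sigma> * \<gamma> - 2 * label_effect) \<le> logit \<mu> w \<sigma> i \<omega> k / 1"
          by simp
      qed
    qed
  qed
  have N: "((\<lambda>\<sigma>. 1 - ?N \<sigma> k) \<longlongrightarrow> 0) at_top"
  proof (rule tendsto_sandwich[OF _ _ tendsto_const exp0[of 0]])
    show "\<forall>\<^sub>F \<sigma> in at_top. 0 \<le> 1 - ?N \<sigma> k"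
      using noise_attention_simplex(2)[OF reg k] by simp
    show "\<forall>\<^sub>F \<sigma> in at_top. 1 - ?N \<sigma> k \<le> card ?U * exp (- (\<sigma> * \<gamma> - 0))"
      using eventually_ge_at_top[of 0]
    proof eventually_elim
      case (elim \<sigma>)
      show ?case
        unfolding noise_attention_def
      proof (rule softmax_concentrates[OF finite_nbhd k])
        fix r assume r: "r \<in> ?U" "r \<noteq> k"
        show "- (\<sigma> * noise_dist \<omega> r) + (\<sigma> * \<gamma> - 0) \<le> - (\<sigma> * noise_dist \<omega> k)"
          using mult_left_mono[OF gap[OF r] elim] by (simp add: distrib_left)
      qed
    qed
  qed
  have twice: "((\<lambda>\<sigma>. 2 * (1 - ?A \<sigma> k)) \<longlongrightarrow> 0) at_top" "((\<lambda>\<sigma>. 2 * (1 - ?N \<sigma> k)) \<longlongrightarrow> 0) at_top"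
    by (rule tendsto_mult_right_zero[OF A], rule tendsto_mult_right_zero[OF N])
  have "((\<lambda>\<sigma>. scr \<sigma> 1 \<omega> - label \<omega> k) \<longlongrightarrow> 0) at_top"
  proof (rule Lim_null_comparison)
    show "\<forall>\<^sub>F \<sigma> in at_top. norm (scr \<sigma> 1 \<omega> - label \<omega> k) \<le> 2 * (1 - ?A \<sigma> k)"
      unfolding score_def real_norm_def
      by (intro always_eventually allI abs_weighted_sum_diff_le finite_nbhd k attention_simplex[OF reg]
          regular_abs_label[OF reg])
  qed (rule twice)
  note S = this
  have SN: "((\<lambda>\<sigma>. nscr \<sigma> \<omega> - label \<omega> k) \<longlongrightarrow> 0) at_top"
  proof (rule Lim_null_comparison)
    show "\<forall>\<^sub>F \<sigma> in at_top. norm (nscr \<sigma> \<omega> - label \<omega> k) \<le> 2 * (1 - ?N \<sigma> k)"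
      unfolding noise_score_def real_norm_def
      by (intro always_eventually allI abs_weighted_sum_diff_le finite_nbhd k noise_attention_simplex[OF reg]
          regular_abs_label[OF reg])
  qed (rule twice)
  show "((\<lambda>\<sigma>. scr \<sigma> 1 \<omega> - nscr \<sigma> \<omega>) \<longlongrightarrow> 0) at_top"
    using tendsto_diff[OF S SN] by simp
  have "((\<lambda>\<sigma>. (scr \<sigma> 1 \<omega>)\<^sup>2) \<longlongrightarrow> (label \<omega> k)\<^sup>2) at_top"
    using S by (intro tendsto_intros) (simp add: LIM_zero_iff)
  moreover have "(label \<omega> k)\<^sup>2 = 1"
    using regular_label[OF reg nbhd_less[OF k]] by auto
  ultimately show "((\<lambda>\<sigma>. (scr \<sigma> 1 \<omega>)\<^sup>2) \<longlongrightarrow> 1) at_top" by simp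
  \<comment> \<open>The sum of squares is the average of the weights with respect to themselves,
    hence close to the weight of \<open>k\<close>.\<close>
  have "((\<lambda>\<sigma>. sq_weights \<sigma> 1 \<omega> - ?A \<sigma> k) \<longlongrightarrow> 0) at_top"
  proof (rule Lim_null_comparison)
    show "\<forall>\<^sub>F \<sigma> in at_top. norm (sq_weights \<sigma> 1 \<omega> - ?A \<sigma> k) \<le> 2 * (1 - ?A \<sigma> k)"
      unfolding sq_weights_def real_norm_def power2_eq_square
      using attention_simplex[OF reg]
      by (intro always_eventually allI abs_weighted_sum_diff_le finite_nbhd k) auto
  qed (rule twice)
  from tendsto_diff[OF this A] have "((\<lambda>\<sigma>. sq_weights \<sigma> 1 \<omega> - 1) \<longlongrightarrow> 0) at_top" by simp
  then show "((\<lambda>\<sigma>. sq_weights \<sigma> 1 \<omega>) \<longlongrightarrow> 1) at_top" by (simp add: LIM_zero_iff)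
qed

section \<open>Moments of the score\<close>

lemma score_measurable: "c \<in> {-1, 1} \<Longrightarrow> scr \<sigma> T \<in> borel_measurable (target c)"
  unfolding score_def label_def target_eq
  by (intro sum_nbhd_measurable borel_measurable_times attention_measurable
      borel_measurable_fst_pmf[where f = "\<lambda>g. fst g _"])

lemma sq_weights_measurable: "c \<in> {-1, 1} \<Longrightarrow> sq_weights \<sigma> T \<in> borel_measurable (target c)"
  unfolding sq_weights_def target_eq
  by (intro sum_nbhd_measurable borel_measurable_power attention_measurable)

lemma noise_attention_measurable:
  assumes j: "j < n"
  shows "(\<lambda>\<omega>. noise_attention i w \<theta> (snd \<omega>) (nbhd n i \<omega>) j)
    \<in> borel_measurable (measure_pmf p \<Otimes>\<^sub>M noise_space {..<n})"
  unfolding noise_attention_def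
  by (intro softmax_nbhd_measurable j borel_measurable_uminus borel_measurable_times borel_measurable_const
      wl1_measurable snd_measurable i_less_n)

lemma noise_score_measurable: "c \<in> {-1, 1} \<Longrightarrow> nscr \<theta> \<in> borel_measurable (target c)"
  unfolding noise_score_def label_def target_eq
  by (intro sum_nbhd_measurable borel_measurable_times noise_attention_measurable
      borel_measurable_fst_pmf[where f = "\<lambda>g. fst g _"])

lemma noise_sq_weights_measurable: "c \<in> {-1, 1} \<Longrightarrow> noise_sq_weights \<theta> \<in> borel_measurable (target c)"
  unfolding noise_sq_weights_def target_eq
  by (intro sum_nbhd_measurable borel_measurable_power noise_attention_measurable)

lemma integrable_target:
  fixes f :: "'d outcome \<Rightarrow> real"
  assumes c: "c \<in> {-1, 1}" and f: "f \<in> borel_measurable (target c)"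
    and le: "\<And>\<omega>. regular \<omega> \<Longrightarrow> \<bar>f \<omega>\<bar> \<le> K"
  shows "integrable (target c) f"
proof -
  interpret prob_space "target c" by (rule prob_space_target[OF c])
  have "AE \<omega> in target c. norm (f \<omega>) \<le> K"
    using AE_regular[OF c] by eventually_elim (use le in simp)
  then show ?thesis using f by (rule integrable_const_bound)
qed

lemma integrable_score: "c \<in> {-1, 1} \<Longrightarrow> integrable (target c) (scr \<sigma> T)"
  by (rule integrable_target[OF _ score_measurable abs_score_le])

lemma integrable_score_square: "c \<in> {-1, 1} \<Longrightarrow> integrable (target c) (\<lambda>\<omega>. (scr \<sigma> T \<omega>)\<^sup>2)"
  by (rule integrable_target[OF _ borel_measurable_power[OF score_measurable] square_le_1[OF abs_score_le]])

lemma integrable_noise_score: "c \<in> {-1, 1} \<Longrightarrow> integrable (target c) (nscr \<theta>)"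
  by (rule integrable_target[OF _ noise_score_measurable abs_noise_score_le])

lemma integrable_noise_score_square: "c \<in> {-1, 1} \<Longrightarrow> integrable (target c) (\<lambda>\<omega>. (nscr \<theta> \<omega>)\<^sup>2)"
  by (rule integrable_target[OF _ borel_measurable_power[OF noise_score_measurable] square_le_1[OF abs_noise_score_le]])

lemma integrable_sq_weights: "c \<in> {-1, 1} \<Longrightarrow> integrable (target c) (sq_weights \<sigma> T)"
  by (rule integrable_target[OF _ sq_weights_measurable abs_sq_weights_le])

lemma integrable_noise_sq_weights: "c \<in> {-1, 1} \<Longrightarrow> integrable (target c) (noise_sq_weights \<theta>)"
  by (rule integrable_target[OF _ noise_sq_weights_measurable abs_noise_sq_weights_le])

section \<open>Exact moments of the noise score\<close>

lemma expectation_target: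
  fixes f :: "'d outcome \<Rightarrow> real"
  assumes c: "c \<in> {-1, 1}" and f: "integrable (target c) f"
  shows "(\<integral>\<omega>. f \<omega> \<partial>target c) = (\<integral>x. measure_pmf.expectation (target_graph c) (\<lambda>g. f (g, x)) \<partial>noise_space {..<n})"
proof -
  interpret P: pair_prob_space "measure_pmf (target_graph c)" "noise_space {..<n} :: (nat \<Rightarrow> real^'d) measure"
    by (rule pair_prob_space_target)
  show ?thesis
    using P.integral_snd[of "\<lambda>g x. f (g, x)"] f by (simp add: target_eq[OF c])
qed

lemma target_graph_nonempty:
  assumes "c \<in> {-1, 1}" "g \<in> set_pmf (target_graph c)"
  shows "graph_nbhd n i g \<noteq> {}"
proof -
  have "card (graph_nbhd n i g) \<in> Ks"
    using assms(2) set_cond_pmf[OF target_event_possible[OF assms(1)]] by auto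
  then show ?thesis using Ks_sub by auto
qed

text \<open>Fubini with the noise outermost: for fixed noise the weights are determined by the
  neighbourhood and sum to 1, so the mean does not depend on \<theta>.\<close>

lemma expectation_noise_score:
  assumes c: "c \<in> {-1, 1}"
  shows "(\<integral>\<omega>. nscr \<theta> \<omega> \<partial>target c) = m * c"
proof -
  interpret N: prob_space "noise_space {..<n} :: (nat \<Rightarrow> real^'d) measure"
    by (rule prob_space_noise)
  have "measure_pmf.expectation (target_graph c) (\<lambda>g. nscr \<theta> (g, x)) = m * c" for x
  proof -
    have "measure_pmf.expectation (target_graph c) (\<lambda>g. nscr \<theta> (g, x))
      = m * c * measure_pmf.expectation (target_graph c)
          (\<lambda>g. \<Sum>j\<in>graph_nbhd n i g. noise_attention i w \<theta> x (graph_nbhd n i g) j)"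
      unfolding noise_score_def nbhd_eq_graph_nbhd label_def fst_conv snd_conv
      by (rule expectation_weighted_labels[OF c])
    also have "measure_pmf.expectation (target_graph c)
        (\<lambda>g. \<Sum>j\<in>graph_nbhd n i g. noise_attention i w \<theta> x (graph_nbhd n i g) j)
      = measure_pmf.expectation (target_graph c) (\<lambda>_. 1)"
      using target_graph_nonempty[OF c]
      by (intro integral_cong_AE AE_pmfI) (auto simp: noise_attention_def sum_softmax)
    finally show ?thesis by simp
  qed
  then show ?thesis
    by (simp add: expectation_target[OF c integrable_noise_score[OF c]] N.prob_space)
qed

lemma expectation_noise_score_square:
  assumes c: "c \<in> {-1, 1}"
  shows "(\<integral>\<omega>. (nscr \<theta> \<omega>)\<^sup>2 \<partial>target c) = m\<^sup>2 + (1 - m\<^sup>2) * (\<integral>\<omega>. noise_sq_weights \<theta> \<omega> \<partial>target c)"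
proof -
  interpret T: prob_space "target c" by (rule prob_space_target[OF c])
  have int: "integrable (target c) (\<lambda>\<omega>. m\<^sup>2 + (1 - m\<^sup>2) * noise_sq_weights \<theta> \<omega>)"
    using integrable_noise_sq_weights[OF c] by simp
  have "measure_pmf.expectation (target_graph c) (\<lambda>g. (nscr \<theta> (g, x))\<^sup>2)
    = measure_pmf.expectation (target_graph c) (\<lambda>g. m\<^sup>2 + (1 - m\<^sup>2) * noise_sq_weights \<theta> (g, x))" for x
  proof -
    have "measure_pmf.expectation (target_graph c) (\<lambda>g. (nscr \<theta> (g, x))\<^sup>2)
      = measure_pmf.expectation (target_graph c)
          (\<lambda>g. m\<^sup>2 * (\<Sum>j\<in>graph_nbhd n i g. noise_attention i w \<theta> x (graph_nbhd n i g) j)\<^sup>2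
            + (1 - m\<^sup>2) * (\<Sum>j\<in>graph_nbhd n i g. (noise_attention i w \<theta> x (graph_nbhd n i g) j)\<^sup>2))"
      unfolding noise_score_def nbhd_eq_graph_nbhd label_def fst_conv snd_conv
      by (rule expectation_weighted_labels_square[OF c])
    also have "\<dots> = measure_pmf.expectation (target_graph c) (\<lambda>g. m\<^sup>2 + (1 - m\<^sup>2) * noise_sq_weights \<theta> (g, x))"
      using target_graph_nonempty[OF c]
      by (intro integral_cong_AE AE_pmfI)
         (auto simp: noise_attention_def sum_softmax noise_sq_weights_def nbhd_eq_graph_nbhd)
    finally show ?thesis .
  qed
  then have "(\<integral>\<omega>. (nscr \<theta> \<omega>)\<^sup>2 \<partial>target c) = (\<integral>\<omega>. m\<^sup>2 + (1 - m\<^sup>2) * noise_sq_weights \<theta> \<omega> \<partial>target c)"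
    by (simp add: expectation_target[OF c integrable_noise_score_square[OF c]] expectation_target[OF c int])
  then show ?thesis
    using integrable_noise_sq_weights[OF c, of \<theta>] by (simp add: T.prob_space)
qed

text \<open>A lower bound on all attention weights that is uniform in \<open>\<theta> \<le> 1\<close>, i.e. in \<open>T \<ge> \<sigma>\<close>.\<close>

definition spread :: "(nat \<Rightarrow> real^'d) \<Rightarrow> real" where
  "spread x = exp (- (\<Sum>r<n. wl1 w (x i) (x r))) / n"

lemma spread_bounds: "0 < spread x" "spread x \<le> 1"
proof -
  have "0 \<le> (\<Sum>r<n. wl1 w (x i) (x r))"
    by (intro sum_nonneg wl1_nonneg w_pos)
  then have "exp (- (\<Sum>r<n. wl1 w (x i) (x r))) \<le> 1" by simp
  also have "\<dots> \<le> n" using i_less_n by simp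
  finally show "spread x \<le> 1" using i_less_n unfolding spread_def by (simp add: divide_le_eq)
  show "0 < spread x" using i_less_n unfolding spread_def by simp
qed

text \<open>Replacing a single distance by the sum over all nodes makes the bound independent of the
  graph.\<close>

lemma spread_le_noise_attention:
  assumes j: "j \<in> nbhd n i \<omega>" and \<theta>: "0 \<le> \<theta>" "\<theta> \<le> 1"
  shows "spread (snd \<omega>) \<le> noise_attention i w \<theta> (snd \<omega>) (nbhd n i \<omega>) j"
proof -
  have card: "0 < card (nbhd n i \<omega>)" "card (nbhd n i \<omega>) \<le> n"
  proof -
    show "0 < card (nbhd n i \<omega>)" using j by (auto simp: card_gt_0_iff)
    have "card (nbhd n i \<omega>) \<le> card {..<n}"
      by (intro card_mono) (auto dest: nbhd_less)
    then show "card (nbhd n i \<omega>) \<le> n" by simp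
  qed
  have "\<theta> * noise_dist \<omega> j \<le> noise_dist \<omega> j"
    using \<theta> wl1_nonneg[OF w_pos] by (simp add: mult_left_le_one_le)
  also have "\<dots> \<le> (\<Sum>r<n. noise_dist \<omega> r)"
    using nbhd_less[OF j] wl1_nonneg[OF w_pos] by (intro member_le_sum) auto
  finally have le: "- (\<Sum>r<n. noise_dist \<omega> r) \<le> - (\<theta> * noise_dist \<omega> j)" by simp
  have "spread (snd \<omega>) \<le> exp (- (\<Sum>r<n. noise_dist \<omega> r)) / card (nbhd n i \<omega>)"
    unfolding spread_def using card by (intro divide_left_mono) auto
  also have "\<dots> \<le> noise_attention i w \<theta> (snd \<omega>) (nbhd n i \<omega>) j"
    unfolding noise_attention_def
    by (rule softmax_ge[OF finite_nbhd j]) (use le \<theta> wl1_nonneg[OF w_pos] in auto)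
  finally show ?thesis .
qed

text \<open>As \<open>spread\<close> depends on the noise alone, this mean is the same under both
  conditionings on the label of \<open>i\<close>. It is the margin that separates T \<ge> \<sigma>
  from T = 1.\<close>

definition mean_spread :: real where
  "mean_spread = (\<integral>x. spread x \<partial>noise_space {..<n})"

lemma spread_measurable: "spread \<in> borel_measurable (noise_space {..<n})"
  unfolding spread_def[abs_def] using i_less_n
  by (intro borel_measurable_divide measurable_compose[OF _ borel_measurable_exp] borel_measurable_uminus
      borel_measurable_sum wl1_measurable noise_component_measurable borel_measurable_const) auto

lemma mean_spread_pos: "0 < mean_spread"
proof -
  interpret N: prob_space "noise_space {..<n} :: (nat \<Rightarrow> real^'d) measure"
    by (rule prob_space_noise)
  have int: "integrable (noise_space {..<n}) spread"
    using spread_bounds spread_measurable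
    by (intro N.integrable_const_bound[where B = 1]) (auto simp: less_imp_le)
  have "(\<integral>x. 0 \<partial>(noise_space {..<n} :: (nat \<Rightarrow> real^'d) measure)) < mean_spread"
    unfolding mean_spread_def
    by (rule N.integral_less_AE_space) (auto simp: int spread_bounds N.emeasure_space_1)
  then show ?thesis by simp
qed

text \<open>The upper bound keeps the high-temperature variance below its limit at T = 1; the lower
  bound keeps it positive, as the division in \<open>SNR\<close> requires.\<close>

lemma expectation_noise_sq_weights_bounds:
  assumes c: "c \<in> {-1, 1}" and \<theta>: "0 \<le> \<theta>" "\<theta> \<le> 1"
  shows "mean_spread \<le> (\<integral>\<omega>. noise_sq_weights \<theta> \<omega> \<partial>target c)"
    and "(\<integral>\<omega>. noise_sq_weights \<theta> \<omega> \<partial>target c) \<le> 1 - mean_spread"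
proof -
  interpret T: prob_space "target c" by (rule prob_space_target[OF c])
  have meas: "(\<lambda>\<omega>. spread (snd \<omega>)) \<in> borel_measurable (target c)"
    unfolding target_eq[OF c] by (rule measurable_compose[OF measurable_snd spread_measurable])
  have int: "integrable (target c) (\<lambda>\<omega>. spread (snd \<omega>))"
    using spread_bounds by (intro integrable_target[OF c meas, of 1]) (simp add: abs_of_pos)
  have E: "(\<integral>\<omega>. spread (snd \<omega>) \<partial>target c) = mean_spread"
    unfolding expectation_target[OF c int] mean_spread_def by simp
  have bounds: "spread (snd \<omega>) \<le> noise_sq_weights \<theta> \<omega> \<and> noise_sq_weights \<theta> \<omega> \<le> 1 - spread (snd \<omega>)"
    if "regular \<omega>" for \<omega>
    using sum_softmax_squares_bounds[OF finite_nbhd regular_card[OF that]]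
      spread_le_noise_attention[OF _ \<theta>]
    unfolding noise_sq_weights_def noise_attention_def by blast
  show "mean_spread \<le> (\<integral>\<omega>. noise_sq_weights \<theta> \<omega> \<partial>target c)"
    unfolding E[symmetric]
  proof (rule integral_mono_AE[OF int integrable_noise_sq_weights[OF c]])
    show "AE \<omega> in target c. spread (snd \<omega>) \<le> noise_sq_weights \<theta> \<omega>"
      using AE_regular[OF c] by eventually_elim (use bounds in blast)
  qed
  have "(\<integral>\<omega>. noise_sq_weights \<theta> \<omega> \<partial>target c) \<le> (\<integral>\<omega>. 1 - spread (snd \<omega>) \<partial>target c)"
  proof (rule integral_mono_AE[OF integrable_noise_sq_weights[OF c]])
    show "AE \<omega> in target c. noise_sq_weights \<theta> \<omega> \<le> 1 - spread (snd \<omega>)"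
      using AE_regular[OF c] by eventually_elim (use bounds in blast)
    show "integrable (target c) (\<lambda>\<omega>. 1 - spread (snd \<omega>))" using int by simp
  qed
  also have "\<dots> = 1 - mean_spread"
    using int by (simp add: T.prob_space E)
  finally show "(\<integral>\<omega>. noise_sq_weights \<theta> \<omega> \<partial>target c) \<le> 1 - mean_spread" .
qed

section \<open>Approximation of the true moments by those of the noise score\<close>

abbreviation "mean \<sigma> T c \<equiv> score_mean n a b i Ks \<mu> w \<sigma> T c"
abbreviation "var \<sigma> T c \<equiv> score_var n a b i Ks \<mu> w \<sigma> T c"

lemma score_mean_close:
  assumes c: "c \<in> {-1, 1}" and \<sigma>: "0 \<le> \<sigma>" and T: "0 < T"
  shows "\<bar>mean \<sigma> T c - m * c\<bar> \<le> perturbation T"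
proof -
  interpret T: prob_space "target c" by (rule prob_space_target[OF c])
  have "AE \<omega> in target c. \<bar>scr \<sigma> T \<omega> - nscr (\<sigma> / T) \<omega>\<bar> \<le> perturbation T"
    using AE_regular[OF c] by eventually_elim (use score_close \<sigma> T in blast)
  then show ?thesis
    using T.abs_expectation_diff_le[OF integrable_score[OF c] integrable_noise_score[OF c]]
    by (simp add: score_mean_def expectation_noise_score[OF c])
qed

lemma score_var_eq:
  assumes c: "c \<in> {-1, 1}"
  shows "var \<sigma> T c = (\<integral>\<omega>. (scr \<sigma> T \<omega>)\<^sup>2 \<partial>target c) - (mean \<sigma> T c)\<^sup>2"
proof -
  interpret T: prob_space "target c" by (rule prob_space_target[OF c])
  show ?thesis
    using T.variance_eq[OF integrable_score[OF c] integrable_score_square[OF c]]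
    by (simp add: score_var_def score_mean_def)
qed

lemma abs_score_mean_le:
  assumes c: "c \<in> {-1, 1}"
  shows "\<bar>mean \<sigma> T c\<bar> \<le> 1"
proof -
  interpret T: prob_space "target c" by (rule prob_space_target[OF c])
  have "AE \<omega> in target c. \<bar>scr \<sigma> T \<omega> - 0\<bar> \<le> 1"
    using AE_regular[OF c] by eventually_elim (simp add: abs_score_le)
  then show ?thesis
    using T.abs_expectation_diff_le[OF integrable_score[OF c], of "\<lambda>_. 0"]
    by (simp add: score_mean_def)
qed

text \<open>The second moment and the squared mean each contribute
  \<open>2 * perturbation T\<close>; the terms \<open>m\<^sup>2\<close> cancel.\<close>

lemma score_var_close:
  assumes c: "c \<in> {-1, 1}" and \<sigma>: "0 \<le> \<sigma>" and T: "0 < T"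
  shows "\<bar>var \<sigma> T c - (1 - m\<^sup>2) * (\<integral>\<omega>. noise_sq_weights (\<sigma> / T) \<omega> \<partial>target c)\<bar> \<le> 4 * perturbation T"
proof -
  interpret T: prob_space "target c" by (rule prob_space_target[OF c])
  have "AE \<omega> in target c. \<bar>(scr \<sigma> T \<omega>)\<^sup>2 - (nscr (\<sigma> / T) \<omega>)\<^sup>2\<bar> \<le> 2 * perturbation T"
    using AE_regular[OF c]
  proof eventually_elim
    case (elim \<omega>)
    show ?case
      using abs_square_diff_le[OF abs_score_le[OF elim] abs_noise_score_le[OF elim]] score_close[OF elim \<sigma> T]
      by (smt (verit))
  qed
  then have "\<bar>(\<integral>\<omega>. (scr \<sigma> T \<omega>)\<^sup>2 \<partial>target c) - (\<integral>\<omega>. (nscr (\<sigma> / T) \<omega>)\<^sup>2 \<partial>target c)\<bar> \<le> 2 * perturbation T"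
    by (intro T.abs_expectation_diff_le integrable_score_square[OF c] integrable_noise_score_square[OF c])
  moreover have "\<bar>(mean \<sigma> T c)\<^sup>2 - (m * c)\<^sup>2\<bar> \<le> 2 * perturbation T"
  proof -
    have "\<bar>m * c\<bar> \<le> 1" using c m_bounds by auto
    then show ?thesis
      using abs_square_diff_le[OF abs_score_mean_le[OF c]] score_mean_close[OF c \<sigma> T]
      by (smt (verit))
  qed
  moreover have "(m * c)\<^sup>2 = m\<^sup>2" using c by auto
  ultimately show ?thesis
    unfolding score_var_eq[OF c] expectation_noise_score_square[OF c] by linarith
qed

lemma expectation_sq_weights_close:
  assumes c: "c \<in> {-1, 1}" and \<sigma>: "0 \<le> \<sigma>" and T: "0 < T"
  shows "\<bar>(\<integral>\<omega>. sq_weights \<sigma> T \<omega> \<partial>target c) - (\<integral>\<omega>. noise_sq_weights (\<sigma> / T) \<omega> \<partial>target c)\<bar>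
    \<le> 2 * perturbation T"
proof -
  interpret T: prob_space "target c" by (rule prob_space_target[OF c])
  have "AE \<omega> in target c. \<bar>sq_weights \<sigma> T \<omega> - noise_sq_weights (\<sigma> / T) \<omega>\<bar> \<le> 2 * perturbation T"
    using AE_regular[OF c] by eventually_elim (use sq_weights_close \<sigma> T in blast)
  then show ?thesis
    by (intro T.abs_expectation_diff_le integrable_sq_weights[OF c] integrable_noise_sq_weights[OF c])
qed

text \<open>The weights have average 1/K, so their squared deviations sum to the sum of squares
  minus 1/K. The mean of 1/K depends on neither T nor \<sigma>, which reduces the comparison to
  \<open>sq_weights\<close>.\<close>

lemma concentration_var_eq:
  assumes c: "c \<in> {-1, 1}"
  shows "concentration_var n a b i Ks \<mu> w \<sigma> T c
    = (1 - m\<^sup>2) * ((\<integral>\<omega>. sq_weights \<sigma> T \<omega> \<partial>target c) - (\<integral>\<omega>. 1 / card (nbhd n i \<omega>) \<partial>target c))"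
proof -
  have meas: "(\<lambda>\<omega>. 1 / card (nbhd n i \<omega>) :: real) \<in> borel_measurable (target c)"
    unfolding target_eq[OF c] nbhd_eq_graph_nbhd
    by (rule borel_measurable_fst_pmf[where f = "\<lambda>g. 1 / card (graph_nbhd n i g)"])
  have int: "integrable (target c) (\<lambda>\<omega>. 1 / card (nbhd n i \<omega>) :: real)"
    by (rule integrable_target[OF c meas, of 1]) (use regular_card in \<open>force simp: divide_le_eq\<close>)
  have "(\<Sum>j\<in>nbhd n i \<omega>. (attention n i \<mu> w \<sigma> T \<omega> j - 1 / card (nbhd n i \<omega>))\<^sup>2)
      = sq_weights \<sigma> T \<omega> - 1 / card (nbhd n i \<omega>)" if "regular \<omega>" for \<omega>
  proof -
    let ?K = "real (card (nbhd n i \<omega>))"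
    have K: "?K > 0" using regular_card[OF that] by simp
    have "(\<Sum>j\<in>nbhd n i \<omega>. (attention n i \<mu> w \<sigma> T \<omega> j - 1 / ?K)\<^sup>2)
        = sq_weights \<sigma> T \<omega> - 2 / ?K * (\<Sum>j\<in>nbhd n i \<omega>. attention n i \<mu> w \<sigma> T \<omega> j) + ?K * (1 / ?K)\<^sup>2"
      by (simp add: sq_weights_def power2_diff sum.distrib sum_subtractf sum_distrib_left)
    also have "\<dots> = sq_weights \<sigma> T \<omega> - 1 / ?K"
      using K attention_simplex(3)[OF that] by (simp add: power2_eq_square)
    finally show ?thesis .
  qed
  then have "AE \<omega> in target c. (\<Sum>j\<in>nbhd n i \<omega>. (attention n i \<mu> w \<sigma> T \<omega> j - 1 / card (nbhd n i \<omega>))\<^sup>2)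
      = sq_weights \<sigma> T \<omega> - 1 / card (nbhd n i \<omega>)"
    using AE_regular[OF c] by (auto elim: eventually_mono)
  moreover have "(\<lambda>\<omega>. \<Sum>j\<in>nbhd n i \<omega>. (attention n i \<mu> w \<sigma> T \<omega> j - 1 / card (nbhd n i \<omega>))\<^sup>2)
      \<in> borel_measurable (target c)"
    using meas unfolding target_eq[OF c]
    by (intro sum_nbhd_measurable borel_measurable_power borel_measurable_diff attention_measurable)
  ultimately have "(\<integral>\<omega>. (\<Sum>j\<in>nbhd n i \<omega>. (attention n i \<mu> w \<sigma> T \<omega> j - 1 / card (nbhd n i \<omega>))\<^sup>2) \<partial>target c)
      = (\<integral>\<omega>. sq_weights \<sigma> T \<omega> - 1 / card (nbhd n i \<omega>) \<partial>target c)"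
    using meas sq_weights_measurable[OF c] by (intro integral_cong_AE) auto
  then show ?thesis
    using int integrable_sq_weights[OF c] by (simp add: concentration_var_def)
qed

section \<open>Limits at temperature 1\<close>

lemma expectation_tendsto:
  fixes f :: "real \<Rightarrow> 'd outcome \<Rightarrow> real"
  assumes c: "c \<in> {-1, 1}" and f: "\<And>\<sigma>. f \<sigma> \<in> borel_measurable (target c)"
    and bnd: "\<And>\<sigma> \<omega>. regular \<omega> \<Longrightarrow> \<bar>f \<sigma> \<omega>\<bar> \<le> K"
    and lim: "\<And>\<omega>. regular \<omega> \<Longrightarrow> ((\<lambda>\<sigma>. f \<sigma> \<omega>) \<longlongrightarrow> r) at_top"
  shows "((\<lambda>\<sigma>. \<integral>\<omega>. f \<sigma> \<omega> \<partial>target c) \<longlongrightarrow> r) at_top"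
proof -
  interpret T: prob_space "target c" by (rule prob_space_target[OF c])
  have "((\<lambda>\<sigma>. \<integral>\<omega>. f \<sigma> \<omega> \<partial>target c) \<longlongrightarrow> (\<integral>\<omega>. r \<partial>target c)) at_top"
  proof (rule integral_dominated_convergence_at_top[where w = "\<lambda>_. K"])
    show "AE \<omega> in target c. ((\<lambda>\<sigma>. f \<sigma> \<omega>) \<longlongrightarrow> r) at_top"
      using AE_regular[OF c] by eventually_elim (rule lim)
    have "AE \<omega> in target c. norm (f \<sigma> \<omega>) \<le> K" for \<sigma>
      using AE_regular[OF c] by eventually_elim (use bnd in simp)
    then show "\<forall>\<^sub>F \<sigma> in at_top. AE \<omega> in target c. norm (f \<sigma> \<omega>) \<le> K" by simp
  qed (use f in auto)
  then show ?thesis by (simp add: T.prob_space)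
qed

text \<open>The difference to the noise score tends to 0 in mean, and the noise score has mean
  \<open>m * c\<close> for every \<sigma>.\<close>

lemma score_mean_1_tendsto:
  assumes c: "c \<in> {-1, 1}"
  shows "((\<lambda>\<sigma>. mean \<sigma> 1 c) \<longlongrightarrow> m * c) at_top"
proof -
  have "((\<lambda>\<sigma>. \<integral>\<omega>. scr \<sigma> 1 \<omega> - nscr \<sigma> \<omega> \<partial>target c) \<longlongrightarrow> 0) at_top"
  proof (rule expectation_tendsto[OF c])
    fix \<sigma> show "(\<lambda>\<omega>. scr \<sigma> 1 \<omega> - nscr \<sigma> \<omega>) \<in> borel_measurable (target c)"
      by (intro borel_measurable_diff score_measurable noise_score_measurable c)
    fix \<omega> assume "regular \<omega>"
    then show "\<bar>scr \<sigma> 1 \<omega> - nscr \<sigma> \<omega>\<bar> \<le> 2"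
      using abs_score_le[of \<omega> \<sigma> 1] abs_noise_score_le[of \<omega> \<sigma>] by linarith
  qed (rule low_temperature_limits)
  then have "((\<lambda>\<sigma>. mean \<sigma> 1 c - m * c) \<longlongrightarrow> 0) at_top"
    using integrable_score[OF c] integrable_noise_score[OF c]
    by (simp add: expectation_noise_score[OF c] score_mean_def)
  then show ?thesis by (simp add: LIM_zero_iff)
qed

lemma score_var_1_tendsto:
  assumes c: "c \<in> {-1, 1}"
  shows "((\<lambda>\<sigma>. var \<sigma> 1 c) \<longlongrightarrow> 1 - m\<^sup>2) at_top"
proof -
  have "((\<lambda>\<sigma>. \<integral>\<omega>. (scr \<sigma> 1 \<omega>)\<^sup>2 \<partial>target c) \<longlongrightarrow> 1) at_top"
    by (rule expectation_tendsto[OF c borel_measurable_power[OF score_measurable[OF c]]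
          square_le_1[OF abs_score_le] low_temperature_limits(2)])
  from tendsto_diff[OF this tendsto_power[OF score_mean_1_tendsto[OF c], of 2]]
  have "((\<lambda>\<sigma>. var \<sigma> 1 c) \<longlongrightarrow> 1 - (m * c)\<^sup>2) at_top"
    by (simp add: score_var_eq[OF c])
  moreover have "(m * c)\<^sup>2 = m\<^sup>2" using c by auto
  ultimately show ?thesis by simp
qed

lemma expectation_sq_weights_1_tendsto:
  assumes c: "c \<in> {-1, 1}"
  shows "((\<lambda>\<sigma>. \<integral>\<omega>. sq_weights \<sigma> 1 \<omega> \<partial>target c) \<longlongrightarrow> 1) at_top"
  by (rule expectation_tendsto[OF c sq_weights_measurable[OF c] abs_sq_weights_le low_temperature_limits(3)])

section \<open>Uninformative logits\<close>

text \<open>The reference law, free of labels and edges, to which both conditional laws of the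
  logits are compared.\<close>

abbreviation "noise_law \<sigma> S B \<equiv>
  (\<integral>x. indicator B (\<lambda>j\<in>S. - (\<sigma> * wl1 w (x i) (x j))) \<partial>(noise_space {..<n} :: (nat \<Rightarrow> real^'d) measure)) :: real"

text \<open>A node's noise is shifted by \<mu> / \<sigma> or its negative according to its label;
  adding both costs covers either sign.\<close>

definition shift_bound :: "real \<Rightarrow> real" where
  "shift_bound \<sigma> = n * (gaussian_shift (inverse \<sigma> *\<^sub>R \<mu>) + gaussian_shift (inverse \<sigma> *\<^sub>R (- \<mu>)))"

lemma shift_bound_tendsto_0: "(shift_bound \<longlongrightarrow> 0) at_top"
proof -
  have "(shift_bound \<longlongrightarrow> real n * (0 + 0)) at_top"
    unfolding shift_bound_def[abs_def] by (intro tendsto_intros gaussian_shift_tendsto_0)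
  then show ?thesis by simp
qed

text \<open>A feature is \<sigma> times the noise shifted by \<open>t\<close>, so given the graph
  the logits are the noise logits evaluated at shifted noise.\<close>

lemma logits_given_graph_close:
  assumes g: "g \<in> set_pmf graph_pmf" and S: "S \<subseteq> {..<n}" and \<sigma>: "0 < \<sigma>"
    and B: "B \<in> sets (\<Pi>\<^sub>M j\<in>S. borel)"
  shows "\<bar>(\<integral>x. indicator B (\<lambda>j\<in>S. logit \<mu> w \<sigma> i (g, x) j) \<partial>noise_space {..<n}) - noise_law \<sigma> S B\<bar> \<le> shift_bound \<sigma>"
proof -
  define t where "t j = inverse \<sigma> *\<^sub>R (fst g j *\<^sub>R \<mu>)" for j
  let ?f = "\<lambda>x :: nat \<Rightarrow> real^'d. indicator B (\<lambda>j\<in>S. - (\<sigma> * wl1 w (x i) (x j))) :: real"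
  have "(\<lambda>x. \<lambda>j\<in>S. - (\<sigma> * wl1 w (x i) (x j))) \<in> noise_space {..<n} \<rightarrow>\<^sub>M (\<Pi>\<^sub>M j\<in>S. borel)"
    using S i_less_n
    by (intro measurable_restrict borel_measurable_uminus borel_measurable_times borel_measurable_const
        wl1_measurable noise_component_measurable) auto
  then have f: "?f \<in> borel_measurable (noise_space {..<n})"
    by (rule measurable_compose) (use B in simp)
  have eq: "(\<lambda>j\<in>S. logit \<mu> w \<sigma> i (g, x) j)
      = (\<lambda>j\<in>S. - (\<sigma> * wl1 w ((\<lambda>j\<in>{..<n}. x j + t j) i) ((\<lambda>j\<in>{..<n}. x j + t j) j)))" for x
  proof (rule restrict_ext)
    fix j assume "j \<in> S"
    then have "j < n" using S by auto
    moreover have "feature \<mu> \<sigma> (g, x) k = \<sigma> *\<^sub>R (x k + t k)" for k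
      using \<sigma> by (simp add: feature_def label_def noise_def t_def scaleR_add_right)
    ultimately show "logit \<mu> w \<sigma> i (g, x) j
        = - (\<sigma> * wl1 w ((\<lambda>j\<in>{..<n}. x j + t j) i) ((\<lambda>j\<in>{..<n}. x j + t j) j))"
      using \<sigma> i_less_n by (simp add: logit_eq_wl1 wl1_scaleR)
  qed
  have "\<bar>(\<integral>x. indicator B (\<lambda>j\<in>S. logit \<mu> w \<sigma> i (g, x) j) \<partial>noise_space {..<n}) - noise_law \<sigma> S B\<bar>
      \<le> (\<Sum>j<n. gaussian_shift (t j))"
    unfolding eq by (rule noise_shift_le[where f = ?f, OF _ f]) auto
  also have "\<dots> \<le> (\<Sum>j<n. gaussian_shift (inverse \<sigma> *\<^sub>R \<mu>) + gaussian_shift (inverse \<sigma> *\<^sub>R (- \<mu>)))"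
  proof (rule sum_mono)
    fix j assume "j \<in> {..<n}"
    then have "fst g j = -1 \<or> fst g j = 1" using label_cases[OF g] by auto
    then show "gaussian_shift (t j) \<le> gaussian_shift (inverse \<sigma> *\<^sub>R \<mu>) + gaussian_shift (inverse \<sigma> *\<^sub>R (- \<mu>))"
      unfolding t_def using gaussian_shift_nonneg by auto
  qed
  finally show ?thesis by (simp add: shift_bound_def)
qed

text \<open>The bound is uniform over graphs and survives averaging over any conditional law of the
  graph.\<close>

lemma logit_law_close:
  assumes ne: "set_pmf graph_pmf \<inter> Collect A \<noteq> {}" and S: "S \<subseteq> {..<n}" and \<sigma>: "0 < \<sigma>"
    and B: "B \<in> sets (\<Pi>\<^sub>M j\<in>S. borel)"
  shows "\<bar>measure (logit_law n a b i \<mu> w \<sigma> S (\<lambda>\<omega>. A (fst \<omega>))) B - noise_law \<sigma> S B\<bar> \<le> shift_bound \<sigma>"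
proof -
  let ?G = "cond_pmf graph_pmf (Collect A)"
  let ?N = "noise_space {..<n} :: (nat \<Rightarrow> real^'d) measure"
  let ?P = "measure_pmf ?G \<Otimes>\<^sub>M ?N"
  let ?L = "\<lambda>\<omega> :: 'd outcome. \<lambda>j\<in>S. logit \<mu> w \<sigma> i \<omega> j"
  interpret N: prob_space ?N by (rule prob_space_noise)
  interpret P: pair_prob_space "measure_pmf ?G" ?N ..
  have L: "?L \<in> ?P \<rightarrow>\<^sub>M (\<Pi>\<^sub>M j\<in>S. borel)"
    using S by (intro measurable_restrict logit_measurable) auto
  then have ind: "(\<lambda>\<omega>. indicator B (?L \<omega>) :: real) \<in> borel_measurable ?P"
    by (rule measurable_compose) (use B in simp)
  have int: "integrable ?P (\<lambda>\<omega>. indicator B (?L \<omega>) :: real)"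
    by (rule P.integrable_const_bound[where B = 1, OF _ ind]) (auto simp: indicator_def)
  have "measure (logit_law n a b i \<mu> w \<sigma> S (\<lambda>\<omega>. A (fst \<omega>))) B
      = (\<integral>\<omega>. indicator B (?L \<omega>) \<partial>?P)"
  proof -
    have "measure (logit_law n a b i \<mu> w \<sigma> S (\<lambda>\<omega>. A (fst \<omega>))) B
        = measure (distr ?P (\<Pi>\<^sub>M j\<in>S. borel) ?L) B"
      unfolding logit_law_def uniform_measure_csbm[OF ne] ..
    also have "\<dots> = (\<integral>z. indicator B z \<partial>distr ?P (\<Pi>\<^sub>M j\<in>S. borel) ?L)"
      using sets.sets_into_space[OF B] by (simp add: Int_absorb2)
    also have "\<dots> = (\<integral>\<omega>. indicator B (?L \<omega>) \<partial>?P)"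
      using B by (intro integral_distr L) simp
    finally show ?thesis .
  qed
  also have "\<dots> = measure_pmf.expectation ?G (\<lambda>g. \<integral>x. indicator B (?L (g, x)) \<partial>?N)"
    by (rule P.integral_fst'[OF int, symmetric])
  finally have E: "measure (logit_law n a b i \<mu> w \<sigma> S (\<lambda>\<omega>. A (fst \<omega>))) B
      = measure_pmf.expectation ?G (\<lambda>g. \<integral>x. indicator B (?L (g, x)) \<partial>?N)" .
  have fin: "finite (set_pmf ?G)"
    using finite_set_graph_pmf set_cond_pmf[OF ne] by simp
  have "\<bar>measure_pmf.expectation ?G (\<lambda>g. \<integral>x. indicator B (?L (g, x)) \<partial>?N)
      - measure_pmf.expectation ?G (\<lambda>_. noise_law \<sigma> S B)\<bar> \<le> shift_bound \<sigma>"
    by (intro measure_pmf.abs_expectation_diff_le integrable_measure_pmf_finite[OF fin] AE_pmfI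
        logits_given_graph_close S \<sigma> B) (use set_cond_pmf[OF ne] in auto)
  then show ?thesis unfolding E by simp
qed

text \<open>Both conditional laws are within \<open>shift_bound \<sigma>\<close> of the same noise
  law, uniformly over measurable sets.\<close>

lemma logits_uninformative: "logits_asymp_uninformative n a b i Ks \<mu> w"
  unfolding logits_asymp_uninformative_def
proof (intro ballI allI impI)
  fix c :: real and S s
  assume c: "c \<in> {-1, 1}" and S: "S \<subseteq> {..<n} - {i}" and s: "\<forall>j\<in>S. s j \<in> {-1, 1 :: real}"
  let ?P = "\<lambda>\<sigma>. logit_law n a b i \<mu> w \<sigma> S
    (\<lambda>\<omega>. label \<omega> i = c \<and> nbhd n i \<omega> = S \<and> (\<forall>j\<in>S. label \<omega> j = s j))"
  let ?Q = "\<lambda>\<sigma>. logit_law n a b i \<mu> w \<sigma> S (\<lambda>\<omega>. label \<omega> i = c \<and> nbhd n i \<omega> = S)"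
  have S': "S \<subseteq> {..<n}" using S by auto
  note poss = nbhd_labels_possible[OF S c s]
  have close: "\<bar>measure (?P \<sigma>) B - measure (?Q \<sigma>) B\<bar> \<le> 2 * shift_bound \<sigma>"
    if \<sigma>: "0 < \<sigma>" and B: "B \<in> sets (\<Pi>\<^sub>M j\<in>S. borel)" for \<sigma> B
  proof -
    have "\<bar>measure (?P \<sigma>) B - noise_law \<sigma> S B\<bar> \<le> shift_bound \<sigma>"
      using logit_law_close[OF _ S' \<sigma> B, of "\<lambda>g. fst g i = c \<and> graph_nbhd n i g = S \<and> (\<forall>j\<in>S. fst g j = s j)"] poss
      by (auto simp: label_def nbhd_eq_graph_nbhd)
    moreover have "\<bar>measure (?Q \<sigma>) B - noise_law \<sigma> S B\<bar> \<le> shift_bound \<sigma>"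
      using logit_law_close[OF _ S' \<sigma> B, of "\<lambda>g. fst g i = c \<and> graph_nbhd n i g = S"] poss
      by (auto simp: label_def nbhd_eq_graph_nbhd)
    ultimately show ?thesis by linarith
  qed
  show "((\<lambda>\<sigma>. tv_dist (?P \<sigma>) (?Q \<sigma>)) \<longlongrightarrow> 0) at_top"
  proof (rule tendsto_sandwich[OF _ _ tendsto_const tendsto_mult_right_zero[OF shift_bound_tendsto_0]])
    have bounds: "0 \<le> tv_dist (?P \<sigma>) (?Q \<sigma>)" "tv_dist (?P \<sigma>) (?Q \<sigma>) \<le> 2 * shift_bound \<sigma>"
      if "0 < \<sigma>" for \<sigma>
      using tv_dist_bounds[of "?P \<sigma>" "?Q \<sigma>", unfolded sets_logit_law, OF close[OF that]] by blast+
    show "\<forall>\<^sub>F \<sigma> in at_top. 0 \<le> tv_dist (?P \<sigma>) (?Q \<sigma>)"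
      using eventually_gt_at_top[of 0] by eventually_elim (rule bounds)
    show "\<forall>\<^sub>F \<sigma> in at_top. tv_dist (?P \<sigma>) (?Q \<sigma>) \<le> 2 * shift_bound \<sigma>"
      using eventually_gt_at_top[of 0] by eventually_elim (rule bounds)
  qed
qed

section \<open>Comparison of temperatures\<close>

abbreviation "sgnl \<sigma> T \<equiv> signal n a b i Ks \<mu> w \<sigma> T"

lemma signal_bounds:
  assumes \<eta>: "0 < \<eta>"
  shows "\<forall>\<^sub>F \<sigma> in at_top. \<bar>sgnl \<sigma> 1 - 2 * m\<bar> < \<eta> \<and> (\<forall>T\<ge>\<sigma>. \<bar>sgnl \<sigma> T - 2 * m\<bar> < \<eta>)"
proof -
  have "((\<lambda>\<sigma>. sgnl \<sigma> 1) \<longlongrightarrow> m * 1 - m * (-1)) at_top"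
    unfolding signal_def by (intro tendsto_diff score_mean_1_tendsto) auto
  then have "\<forall>\<^sub>F \<sigma> in at_top. \<bar>sgnl \<sigma> 1 - 2 * m\<bar> < \<eta>"
    using tendstoD[OF _ \<eta>] by (force simp: dist_real_def)
  \<comment> \<open>Half of \<eta>, because both conditional means enter the signal.\<close>
  moreover have "\<forall>\<^sub>F \<sigma> in at_top. \<bar>perturbation \<sigma>\<bar> < \<eta> / 2"
    using tendstoD[OF perturbation_tendsto_0, of "\<eta> / 2"] \<eta> by (simp add: dist_real_def)
  ultimately show ?thesis
    using eventually_gt_at_top[of 0]
  proof eventually_elim
    case (elim \<sigma>)
    have "\<bar>sgnl \<sigma> T - 2 * m\<bar> < \<eta>" if "\<sigma> \<le> T" for T
      using score_mean_close[of 1 \<sigma> T] score_mean_close[of "-1" \<sigma> T] perturbation_antimono[of \<sigma> T]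
        elim that unfolding signal_def by auto
    with elim show ?case by blast
  qed
qed

text \<open>With \<delta> = \<open>mean_spread\<close>, the limits at T = 1 are \<open>v\<close> and
  1, while for T \<ge> \<sigma> the noise quantities stay a proportion \<delta> below. The fractions
  of \<delta> leave room for the errors on both sides.\<close>

lemma variance_bounds:
  assumes c: "c \<in> {-1, 1}"
  defines "v \<equiv> 1 - m\<^sup>2"
  shows "\<forall>\<^sub>F \<sigma> in at_top. v * (1 - mean_spread / 4) < var \<sigma> 1 c \<and>
    (\<forall>T\<ge>\<sigma>. 0 < var \<sigma> T c \<and> var \<sigma> T c \<le> v * (1 - 3 / 4 * mean_spread) \<and>
      concentration_var n a b i Ks \<mu> w \<sigma> T c < concentration_var n a b i Ks \<mu> w \<sigma> 1 c)"
proof -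
  have v: "0 < v" "v \<le> 1"
    using m_bounds by (auto simp: v_def power_less_one_iff)
  let ?\<delta> = mean_spread
  have \<delta>: "0 < ?\<delta>" by (rule mean_spread_pos)
  have v\<delta>: "0 < v * ?\<delta>" "v * ?\<delta> \<le> ?\<delta>" using v \<delta> by auto
  have "\<forall>\<^sub>F \<sigma> in at_top. v * (1 - ?\<delta> / 4) < var \<sigma> 1 c"
    by (rule order_tendstoD(1)[OF score_var_1_tendsto[OF c]]) (use v\<delta> in \<open>simp add: v_def[symmetric] algebra_simps\<close>)
  moreover have "\<forall>\<^sub>F \<sigma> in at_top. 1 - ?\<delta> / 2 < (\<integral>\<omega>. sq_weights \<sigma> 1 \<omega> \<partial>target c)"
    by (rule order_tendstoD(1)[OF expectation_sq_weights_1_tendsto[OF c]]) (use \<delta> in simp)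
  \<comment> \<open>The factor 4 in \<open>score_var_close\<close> turns this into a loss of a
    quarter of \<open>v * \<delta>\<close>, which gives the fraction 3/4.\<close>
  moreover have "\<forall>\<^sub>F \<sigma> in at_top. perturbation \<sigma> < v * ?\<delta> / 16"
    by (rule order_tendstoD(2)[OF perturbation_tendsto_0]) (use v\<delta> in simp)
  ultimately show ?thesis
    using eventually_gt_at_top[of 0]
  proof eventually_elim
    case (elim \<sigma>)
    have "0 < var \<sigma> T c \<and> var \<sigma> T c \<le> v * (1 - 3 / 4 * ?\<delta>) \<and>
        concentration_var n a b i Ks \<mu> w \<sigma> T c < concentration_var n a b i Ks \<mu> w \<sigma> 1 c" if T: "\<sigma> \<le> T" for T
    proof -
      let ?E = "\<integral>\<omega>. noise_sq_weights (\<sigma> / T) \<omega> \<partial>target c"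
      have T': "0 < T" "0 \<le> \<sigma>" and \<theta>: "0 \<le> \<sigma> / T" "\<sigma> / T \<le> 1" using elim T by auto
      have \<rho>: "perturbation T < v * ?\<delta> / 16"
        using perturbation_antimono[of \<sigma> T] elim T by linarith
      have E: "?\<delta> \<le> ?E" "?E \<le> 1 - ?\<delta>"
        by (rule expectation_noise_sq_weights_bounds[OF c \<theta>])+
      then have vE: "v * ?\<delta> \<le> v * ?E" "v * ?E \<le> v * (1 - ?\<delta>)"
        using v by (auto intro!: mult_left_mono)
      have "\<bar>var \<sigma> T c - v * ?E\<bar> \<le> 4 * perturbation T"
        unfolding v_def by (rule score_var_close[OF c T'(2,1)])
      moreover have "v * (1 - ?\<delta>) = v - v * ?\<delta>" "v * (1 - 3 / 4 * ?\<delta>) = v - 3 / 4 * (v * ?\<delta>)"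
        by (simp_all add: algebra_simps)
      ultimately have "0 < var \<sigma> T c" "var \<sigma> T c \<le> v * (1 - 3 / 4 * ?\<delta>)"
        using vE \<rho> v\<delta> by linarith+
      moreover have "(\<integral>\<omega>. sq_weights \<sigma> T \<omega> \<partial>target c) < (\<integral>\<omega>. sq_weights \<sigma> 1 \<omega> \<partial>target c)"
        using expectation_sq_weights_close[OF c T'(2,1)] E \<rho> v\<delta> elim by linarith
      then have "concentration_var n a b i Ks \<mu> w \<sigma> T c < concentration_var n a b i Ks \<mu> w \<sigma> 1 c"
        unfolding concentration_var_eq[OF c] v_def[symmetric] using v by simp
      ultimately show ?thesis by blast
    qed
    with elim show ?case by blast
  qed
qed

lemma high_temperature_wins:
  "\<forall>\<^sub>F \<sigma> in at_top. \<forall>T\<ge>\<sigma>.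
    (\<forall>c\<in>{-1, 1}.
       concentration_var n a b i Ks \<mu> w \<sigma> T c < concentration_var n a b i Ks \<mu> w \<sigma> 1 c
     \<and> var \<sigma> T c < var \<sigma> 1 c)
    \<and> SNR n a b i Ks \<mu> w \<sigma> T > SNR n a b i Ks \<mu> w \<sigma> 1"
proof -
  define v where "v = 1 - m\<^sup>2"
  have v: "0 < v" using m_bounds by (auto simp: v_def power_less_one_iff)
  let ?\<delta> = mean_spread
  \<comment> \<open>\<open>p\<close> bounds the denominator of \<open>SNR\<close> at T = 1 from
    below, \<open>q\<close> the one at T \<ge> \<sigma> from above; the factor 2 counts the two
    labels.\<close>
  define p where "p = sqrt (2 * (v * (1 - ?\<delta> / 4)))"
  define q where "q = sqrt (2 * (v * (1 - 3 / 4 * ?\<delta>)))"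
  \<comment> \<open>The two bounds at \<theta> = 0 enclose one number between \<delta> and 1 -
    \<delta>, which forces \<delta> \<le> 1/2 and makes \<open>q\<close> positive.\<close>
  have \<delta>: "0 < ?\<delta>" "?\<delta> \<le> 1 / 2"
    using mean_spread_pos expectation_noise_sq_weights_bounds[of 1 0] by auto
  have q: "0 < q" unfolding q_def using v \<delta> by simp
  have pq: "q < p" unfolding p_def q_def using v \<delta> by simp
  \<comment> \<open>half of the largest \<open>\<eta>\<close> with \<open>(2 m + \<eta>) / p \<le> (2 m - \<eta>) / q\<close>\<close>
  define \<eta> where "\<eta> = m * (p - q) / (p + q)"
  have \<eta>: "0 < \<eta>" unfolding \<eta>_def using q pq m_bounds by simp
  have "\<eta> * (p + q) = m * (p - q)" unfolding \<eta>_def using q pq by simp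
  moreover have "0 < m * (p - q)" using pq m_bounds by simp
  ultimately have win: "(2 * m + \<eta>) * q < (2 * m - \<eta>) * p"
    by (simp add: algebra_simps)
  \<comment> \<open>Keeps the signals positive, so that replacing the high-temperature denominator
    by its upper bound lowers the quotient.\<close>
  have "\<eta> < m"
  proof -
    have "m * (p - q) < m * (p + q)" using m_bounds q by simp
    then show ?thesis unfolding \<eta>_def using q pq by (simp add: divide_less_eq)
  qed
  have "\<forall>\<^sub>F \<sigma> in at_top. \<bar>sgnl \<sigma> 1 - 2 * m\<bar> < \<eta> \<and> (\<forall>T\<ge>\<sigma>. \<bar>sgnl \<sigma> T - 2 * m\<bar> < \<eta>)"
    by (rule signal_bounds[OF \<eta>])
  moreover have "(1 :: real) \<in> {-1, 1}" "(-1 :: real) \<in> {-1, 1}" by auto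
  note this[THEN variance_bounds, folded v_def]
  ultimately show ?thesis
  proof eventually_elim
    case (elim \<sigma>)
    show ?case
    proof (intro allI impI)
      fix T assume T: "\<sigma> \<le> T"
      let ?V = "\<lambda>T. var \<sigma> T 1 + var \<sigma> T (-1)"
      have lt: "v * (1 - 3 / 4 * ?\<delta>) < v * (1 - ?\<delta> / 4)"
        using v \<delta> by simp
      have V1: "p \<le> sqrt (?V 1)"
        unfolding p_def using elim by (intro real_sqrt_le_mono) linarith
      have VT: "sqrt (?V T) \<le> q"
        unfolding q_def using elim T by (intro real_sqrt_le_mono) (smt (verit))
      have VT_pos: "0 < sqrt (?V T)"
        using elim T by (intro real_sqrt_gt_zero) (smt (verit))
      have S1: "sgnl \<sigma> 1 < 2 * m + \<eta>" "0 < sgnl \<sigma> 1" and ST: "2 * m - \<eta> < sgnl \<sigma> T"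
        using elim T \<open>\<eta> < m\<close> m_bounds by (smt (verit))+
      have "SNR n a b i Ks \<mu> w \<sigma> 1 = sgnl \<sigma> 1 / sqrt (?V 1)"
        by (simp add: SNR_def)
      also have "\<dots> \<le> (2 * m + \<eta>) / p"
        using S1 V1 q pq by (intro frac_le) auto
      also have "\<dots> < (2 * m - \<eta>) / q"
        using win q pq by (simp add: divide_simps mult.commute)
      also have "\<dots> \<le> sgnl \<sigma> T / sqrt (?V T)"
        using ST VT VT_pos \<open>\<eta> < m\<close> m_bounds by (intro frac_le) auto
      also have "\<dots> = SNR n a b i Ks \<mu> w \<sigma> T"
        by (simp add: SNR_def)
      finally have "SNR n a b i Ks \<mu> w \<sigma> T > SNR n a b i Ks \<mu> w \<sigma> 1" .
      moreover have "var \<sigma> T c < var \<sigma> 1 c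
          \<and> concentration_var n a b i Ks \<mu> w \<sigma> T c < concentration_var n a b i Ks \<mu> w \<sigma> 1 c"
        if "c \<in> {-1, 1}" for c
        using that elim T lt by (smt (verit) insert_iff empty_iff)
      ultimately show "(\<forall>c\<in>{-1, 1}.
         concentration_var n a b i Ks \<mu> w \<sigma> T c < concentration_var n a b i Ks \<mu> w \<sigma> 1 c
         \<and> var \<sigma> T c < var \<sigma> 1 c)
        \<and> SNR n a b i Ks \<mu> w \<sigma> T > SNR n a b i Ks \<mu> w \<sigma> 1" by blast
    qed
  qed
qed

end

theorem theorem1:
  fixes n i :: nat and a b :: real and Ks :: "nat set" and \<mu> w :: "real^('d::finite)"
  assumes "0 < b" and "b < a" and "a \<le> real n"
    and "i < n"
    and "Ks \<noteq> {}" and "Ks \<subseteq> {1<..<n}"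
    and "\<forall>l. 0 < w $ l"
  shows "(\<forall>\<sigma>>0. (SUP T\<in>{0<..}. ereal (SNR n a b i Ks \<mu> w \<sigma> T)) \<ge> ereal (SNR n a b i Ks \<mu> w \<sigma> 1))
    \<and> logits_asymp_uninformative n a b i Ks \<mu> w
    \<and> (\<exists>C>0.
        (\<forall>\<eta>>0. \<forall>\<^sub>F \<sigma> in at_top. \<forall>T\<ge>C * \<sigma>.
            \<bar>signal n a b i Ks \<mu> w \<sigma> T - signal n a b i Ks \<mu> w \<sigma> 1\<bar> < \<eta>
          \<and> \<bar>signal n a b i Ks \<mu> w \<sigma> T - 2 * homophily a b\<bar> < \<eta>)
      \<and> (\<forall>\<^sub>F \<sigma> in at_top. \<forall>T\<ge>C * \<sigma>.
            (\<forall>c\<in>{-1, 1}.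
                concentration_var n a b i Ks \<mu> w \<sigma> T c < concentration_var n a b i Ks \<mu> w \<sigma> 1 c
              \<and> score_var n a b i Ks \<mu> w \<sigma> T c < score_var n a b i Ks \<mu> w \<sigma> 1 c)
          \<and> SNR n a b i Ks \<mu> w \<sigma> T > SNR n a b i Ks \<mu> w \<sigma> 1))"
proof -
  interpret attention_target n i a b Ks \<mu> w
    using assms by unfold_locales auto
  have "\<forall>\<^sub>F \<sigma> in at_top. \<forall>T\<ge>\<sigma>.
      \<bar>sgnl \<sigma> T - sgnl \<sigma> 1\<bar> < \<eta> \<and> \<bar>sgnl \<sigma> T - 2 * m\<bar> < \<eta>" if "0 < \<eta>" for \<eta>
  proof -
    have "\<forall>\<^sub>F \<sigma> in at_top. \<bar>sgnl \<sigma> 1 - 2 * m\<bar> < \<eta> / 2 \<and> (\<forall>T\<ge>\<sigma>. \<bar>sgnl \<sigma> T - 2 * m\<bar> < \<eta> / 2)"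
      using that by (intro signal_bounds) simp
    then show ?thesis
    proof eventually_elim
      case (elim \<sigma>)
      show ?case
      proof (intro allI impI)
        fix T assume "\<sigma> \<le> T"
        then have "\<bar>sgnl \<sigma> T - 2 * m\<bar> < \<eta> / 2" using elim by blast
        then show "\<bar>sgnl \<sigma> T - sgnl \<sigma> 1\<bar> < \<eta> \<and> \<bar>sgnl \<sigma> T - 2 * m\<bar> < \<eta>"
          using elim that by linarith
      qed
    qed
  qed
  \<comment> \<open>The baseline T = 1 is itself a candidate; in \<open>ereal\<close> the supremum
    exists without a boundedness argument.\<close>
  moreover have "ereal (SNR n a b i Ks \<mu> w \<sigma> 1) \<le> (SUP T\<in>{0<..}. ereal (SNR n a b i Ks \<mu> w \<sigma> T))" for \<sigma>
    by (rule SUP_upper) simp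
  \<comment> \<open>The witness is \<open>C = 1\<close>, since the estimates were made for \<sigma>
    / T \<le> 1.\<close>
  ultimately show ?thesis
    using logits_uninformative high_temperature_wins
    by (intro conjI exI[of _ 1] allI impI) simp_all
qed

end
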